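(* Let $n \in \mathbb{N}$ be odd and let $\mathbf{u} = (u_1,u_2,u_3) \in \mathbb{Z}^3$, with all $u_i \neq 0$, be a solution to $$\frac{4}{n} = \frac{1}{u_1} + \frac{1}{u_2} + \frac{1}{u_3}$$ which is not a natural number solution (that is, at least one $u_i$ is negative). Then $$\prod_{p \mid n} (-u_1/u_3, -u_2/u_3)_p = 1,$$ where the product is over the primes $p$ dividing $n$.
   Context: $\mathbb{N}$ denotes the positive integers. For a prime $p$ and $a,b \in \mathbb{Q}_p^*$, $(a,b)_p \in \{\pm 1\}$ denotes the Hilbert symbol: it is $1$ if $z^2 = ax^2+by^2$ has a non-trivial solution in $\mathbb{Q}_p$, and $-1$ otherwise. An empty product equals $1$. *)

theory Defs
  imports Complex_Main "HOL-Computational_Algebra.Primes" "HOL-Algebra.QuotRing"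
begin

text \<open>
  The field of \<open>p\<close>-adic numbers is constructed as the completion of the rationals with respect to
  the \<open>p\<close>-adic absolute value: the ring of Cauchy sequences modulo the ideal of null sequences.
  It is a record with explicit carrier, rather than a type, because the prime varies inside a
  product. The definitions are meaningful for prime \<open>p\<close>.
\<close>

definition padic_abs :: "nat \<Rightarrow> rat \<Rightarrow> real" where
  "padic_abs p x =
     (if x = 0 then 0
      else real p powi (int (multiplicity (int p) (snd (quotient_of x)))
                      - int (multiplicity (int p) (fst (quotient_of x)))))"

definition padic_Cauchy :: "nat \<Rightarrow> (nat \<Rightarrow> rat) \<Rightarrow> bool" where
  "padic_Cauchy p X \<longleftrightarrow> (\<forall>e>0. \<exists>N. \<forall>m\<ge>N. \<forall>n\<ge>N. padic_abs p (X m - X n) < e)"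

definition padic_null :: "nat \<Rightarrow> (nat \<Rightarrow> rat) set" where
  "padic_null p = {X. \<forall>e>0. \<exists>N. \<forall>n\<ge>N. padic_abs p (X n) < e}"

definition padic_Cauchy_ring :: "nat \<Rightarrow> (nat \<Rightarrow> rat) ring" where
  "padic_Cauchy_ring p =
     \<lparr>carrier = {X. padic_Cauchy p X},
      mult = (\<lambda>X Y n. X n * Y n),
      one = (\<lambda>n. 1),
      zero = (\<lambda>n. 0),
      add = (\<lambda>X Y n. X n + Y n)\<rparr>"

definition padic_field :: "nat \<Rightarrow> (nat \<Rightarrow> rat) set ring" where
  "padic_field p = padic_Cauchy_ring p Quot padic_null p"

text \<open>The canonical embedding of the rationals: the class of the constant sequence.\<close>

definition padic_of_rat :: "nat \<Rightarrow> rat \<Rightarrow> (nat \<Rightarrow> rat) set" where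
  "padic_of_rat p q = padic_null p +>\<^bsub>padic_Cauchy_ring p\<^esub> (\<lambda>n. q)"

text \<open>The Hilbert symbol is intended for nonzero \<open>a\<close>, \<open>b\<close> in \<open>carrier (padic_field p)\<close>.\<close>

definition hilbert_symbol :: "nat \<Rightarrow> (nat \<Rightarrow> rat) set \<Rightarrow> (nat \<Rightarrow> rat) set \<Rightarrow> int" where
  "hilbert_symbol p a b =
     (let K = padic_field p in
      if \<exists>x\<in>carrier K. \<exists>y\<in>carrier K. \<exists>z\<in>carrier K.
           \<not> (x = \<zero>\<^bsub>K\<^esub> \<and> y = \<zero>\<^bsub>K\<^esub> \<and> z = \<zero>\<^bsub>K\<^esub>) \<and>
           z [^]\<^bsub>K\<^esub> (2::nat) = a \<otimes>\<^bsub>K\<^esub> x [^]\<^bsub>K\<^esub> (2::nat) \<oplus>\<^bsub>K\<^esub> b \<otimes>\<^bsub>K\<^esub> y [^]\<^bsub>K\<^esub> (2::nat)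
      then 1 else -1)"


subsection \<open>The construction yields a field\<close>

lemma padic_abs_quotient:
  assumes p: "prime p" and ab: "a \<noteq> 0" "b \<noteq> 0"
  shows "padic_abs p (of_int a / of_int b) =
    real p powi (int (multiplicity (int p) b) - int (multiplicity (int p) a))"
proof -
  obtain c d where q: "quotient_of (of_int a / of_int b) = (c, d)" by force
  have d: "d > 0" using quotient_of_denom_pos[OF q] .
  have eq: "(of_int a / of_int b :: rat) = of_int c / of_int d" using quotient_of_div[OF q] .
  have "(of_int (a * d) :: rat) = of_int (c * b)"
    using eq ab d by (simp add: field_simps)
  hence e: "a * d = c * b" by linarith
  have c: "c \<noteq> 0" using e ab d by auto
  have pe: "prime_elem (int p)" using p by auto
  have "multiplicity (int p) a + multiplicity (int p) d = multiplicity (int p) c + multiplicity (int p) b"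
    using e ab c d prime_elem_multiplicity_mult_distrib[OF pe] by (metis less_irrefl)
  hence "int (multiplicity (int p) d) - int (multiplicity (int p) c) =
      int (multiplicity (int p) b) - int (multiplicity (int p) a)" by linarith
  thus ?thesis using q ab by (simp add: padic_abs_def)
qed

lemma padic_abs_0 [simp]: "padic_abs p 0 = 0"
  by (simp add: padic_abs_def)

lemma padic_abs_nonneg: "padic_abs p x \<ge> 0"
  by (simp add: padic_abs_def)

lemma padic_abs_pos: "prime p \<Longrightarrow> x \<noteq> 0 \<Longrightarrow> padic_abs p x > 0"
  by (simp add: padic_abs_def prime_gt_0_nat)

lemma padic_abs_1: "prime p \<Longrightarrow> padic_abs p 1 = 1"
  using padic_abs_quotient[of p 1 1] by simp

lemma rat_eq_quotient:
  obtains a b where "(x::rat) = of_int a / of_int b" "b \<noteq> 0"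
  by (metis quotient_of_denom_pos quotient_of_div less_irrefl surj_pair)

lemma padic_abs_mult:
  assumes p: "prime p"
  shows "padic_abs p (x * y) = padic_abs p x * padic_abs p y"
proof (cases "x = 0 \<or> y = 0")
  case False
  obtain a b where x: "x = of_int a / of_int b" "b \<noteq> 0" by (rule rat_eq_quotient)
  obtain c d where y: "y = of_int c / of_int d" "d \<noteq> 0" by (rule rat_eq_quotient)
  have nz: "a \<noteq> 0" "c \<noteq> 0" using False x y by auto
  have pe: "prime_elem (int p)" using p by auto
  have xy: "x * y = of_int (a * c) / of_int (b * d)" using x y by simp
  have "p \<noteq> 0" using p by auto
  show ?thesis
    unfolding xy unfolding x y using x(2) y(2) nz \<open>p \<noteq> 0\<close>
    by (simp only: padic_abs_quotient[OF p] mult_eq_0_iff simp_thms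
          prime_elem_multiplicity_mult_distrib[OF pe])
       (simp add: power_int_add[symmetric] algebra_simps)
qed auto

lemma padic_abs_minus: "prime p \<Longrightarrow> padic_abs p (- x) = padic_abs p x"
proof -
  assume p: "prime p"
  have "padic_abs p (-1) = 1"
    using padic_abs_quotient[OF p, of "-1" 1] by (simp add: multiplicity_unit_right)
  thus ?thesis using padic_abs_mult[OF p, of "-1" x] by simp
qed

lemma padic_abs_add:
  assumes p: "prime p"
  shows "padic_abs p (x + y) \<le> max (padic_abs p x) (padic_abs p y)"
proof (cases "x = 0 \<or> y = 0 \<or> x + y = 0")
  case True
  thus ?thesis using padic_abs_nonneg[of p] by (auto simp: le_max_iff_disj)
next
  case False
  obtain a b where x: "x = of_int a / of_int b" "b \<noteq> 0" by (rule rat_eq_quotient)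
  obtain c d where y: "y = of_int c / of_int d" "d \<noteq> 0" by (rule rat_eq_quotient)
  have x': "x = of_int (a * d) / of_int (b * d)" and y': "y = of_int (c * b) / of_int (b * d)"
    using x y by auto
  have xy: "x + y = of_int (a * d + c * b) / of_int (b * d)"
    unfolding x' y' by (simp add: add_divide_distrib)
  have nz: "a * d \<noteq> 0" "c * b \<noteq> 0" "b * d \<noteq> 0" "a * d + c * b \<noteq> 0"
    using False x y xy by (auto simp del: of_int_add of_int_mult)
  let ?m = "multiplicity (int p)"
  have unit: "\<not> is_unit (int p)" using p by auto
  have "int p ^ min (?m (a * d)) (?m (c * b)) dvd a * d + c * b"
    by (intro dvd_add multiplicity_dvd') auto
  hence "min (?m (a * d)) (?m (c * b)) \<le> ?m (a * d + c * b)"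
    using power_dvd_iff_le_multiplicity nz unit by blast
  hence "?m (a * d + c * b) \<ge> ?m (a * d) \<or> ?m (a * d + c * b) \<ge> ?m (c * b)" by linarith
  moreover have "real p \<ge> 1" using p prime_ge_1_nat[of p] by simp
  ultimately show ?thesis
    unfolding xy unfolding x' y' padic_abs_quotient[OF p nz(1,3)]
      padic_abs_quotient[OF p nz(2,3)] padic_abs_quotient[OF p nz(4,3)]
    by (auto simp: le_max_iff_disj intro!: power_int_increasing)
qed

lemma padic_abs_add_less:
  "prime p \<Longrightarrow> padic_abs p x < e \<Longrightarrow> padic_abs p y < e \<Longrightarrow> padic_abs p (x + y) < e"
  using padic_abs_add[of p x y] by auto

lemma padic_Cauchy_bounded:
  assumes p: "prime p" and X: "padic_Cauchy p X"
  obtains B where "B > 0" "\<And>n. padic_abs p (X n) \<le> B"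
proof -
  obtain N where N: "\<forall>m\<ge>N. \<forall>n\<ge>N. padic_abs p (X m - X n) < 1"
    using X unfolding padic_Cauchy_def by (meson zero_less_one)
  define B where "B = Max (insert 1 ((\<lambda>n. padic_abs p (X n)) ` {..N}))"
  have B1: "1 \<le> B" and B: "n \<le> N \<Longrightarrow> padic_abs p (X n) \<le> B" for n
    unfolding B_def by (rule Max_ge; simp)+
  have "padic_abs p (X n) \<le> B" for n
  proof (cases "n \<le> N")
    case False
    hence "padic_abs p (X n - X N) \<le> B" using N B1 by (meson le_cases less_imp_le order_refl order_trans)
    thus ?thesis using padic_abs_add[OF p, of "X n - X N" "X N"] B[of N] by simp
  qed (rule B)
  with B1 show ?thesis by (intro that[of B]) auto
qed

lemma padic_Cauchy_const: "padic_Cauchy p (\<lambda>n. q)"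
  by (simp add: padic_Cauchy_def)

lemma padic_Cauchy_add:
  assumes p: "prime p" and X: "padic_Cauchy p X" and Y: "padic_Cauchy p Y"
  shows "padic_Cauchy p (\<lambda>n. X n + Y n)"
  unfolding padic_Cauchy_def
proof (intro allI impI)
  fix e :: real assume e: "e > 0"
  obtain M where M: "\<forall>m\<ge>M. \<forall>n\<ge>M. padic_abs p (X m - X n) < e"
    using X e unfolding padic_Cauchy_def by blast
  obtain N where N: "\<forall>m\<ge>N. \<forall>n\<ge>N. padic_abs p (Y m - Y n) < e"
    using Y e unfolding padic_Cauchy_def by blast
  have "padic_abs p (X m + Y m - (X n + Y n)) < e" if "m \<ge> max M N" "n \<ge> max M N" for m n
    using padic_abs_add_less[OF p, of "X m - X n" e "Y m - Y n"] M N that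
    by (simp add: algebra_simps)
  thus "\<exists>N. \<forall>m\<ge>N. \<forall>n\<ge>N. padic_abs p (X m + Y m - (X n + Y n)) < e" by blast
qed

lemma padic_Cauchy_mult:
  assumes p: "prime p" and X: "padic_Cauchy p X" and Y: "padic_Cauchy p Y"
  shows "padic_Cauchy p (\<lambda>n. X n * Y n)"
  unfolding padic_Cauchy_def
proof (intro allI impI)
  fix e :: real assume e: "e > 0"
  obtain B where B: "B > 0" "\<And>n. padic_abs p (X n) \<le> B" using padic_Cauchy_bounded[OF p X] by blast
  obtain C where C: "C > 0" "\<And>n. padic_abs p (Y n) \<le> C" using padic_Cauchy_bounded[OF p Y] by blast
  have "e / C > 0" "e / B > 0" using e B C by auto
  obtain M where M: "\<forall>m\<ge>M. \<forall>n\<ge>M. padic_abs p (X m - X n) < e / C"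
    using X \<open>e / C > 0\<close> unfolding padic_Cauchy_def by blast
  obtain N where N: "\<forall>m\<ge>N. \<forall>n\<ge>N. padic_abs p (Y m - Y n) < e / B"
    using Y \<open>e / B > 0\<close> unfolding padic_Cauchy_def by blast
  have "padic_abs p (X m * Y m - X n * Y n) < e" if "m \<ge> max M N" "n \<ge> max M N" for m n
  proof -
    have "padic_abs p ((X m - X n) * Y m) \<le> padic_abs p (X m - X n) * C"
      unfolding padic_abs_mult[OF p] by (intro mult_left_mono C padic_abs_nonneg)
    also have "\<dots> < e" using M that C by (simp add: field_simps)
    finally have 1: "padic_abs p ((X m - X n) * Y m) < e" .
    have "padic_abs p (X n * (Y m - Y n)) \<le> B * padic_abs p (Y m - Y n)"
      unfolding padic_abs_mult[OF p] by (intro mult_right_mono B padic_abs_nonneg)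
    also have "\<dots> < e" using N that B by (simp add: field_simps)
    finally have 2: "padic_abs p (X n * (Y m - Y n)) < e" .
    show ?thesis using padic_abs_add_less[OF p 1 2] by (simp add: algebra_simps)
  qed
  thus "\<exists>N. \<forall>m\<ge>N. \<forall>n\<ge>N. padic_abs p (X m * Y m - X n * Y n) < e" by blast
qed

lemma padic_Cauchy_uminus:
  assumes p: "prime p" and X: "padic_Cauchy p X"
  shows "padic_Cauchy p (\<lambda>n. - X n)"
  using padic_Cauchy_mult[OF p padic_Cauchy_const[of p "-1"] X] by simp

lemma padic_Cauchy_ring_simps [simp]:
  "carrier (padic_Cauchy_ring p) = {X. padic_Cauchy p X}"
  "X \<otimes>\<^bsub>padic_Cauchy_ring p\<^esub> Y = (\<lambda>n. X n * Y n)"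
  "\<one>\<^bsub>padic_Cauchy_ring p\<^esub> = (\<lambda>n. 1)"
  "\<zero>\<^bsub>padic_Cauchy_ring p\<^esub> = (\<lambda>n. 0)"
  "X \<oplus>\<^bsub>padic_Cauchy_ring p\<^esub> Y = (\<lambda>n. X n + Y n)"
  by (simp_all add: padic_Cauchy_ring_def)

lemma padic_Cauchy_ring_cring:
  assumes p: "prime p"
  shows "cring (padic_Cauchy_ring p)"
proof (rule cringI)
  have "\<exists>Y. padic_Cauchy p Y \<and> (\<lambda>n. Y n + X n) = (\<lambda>n. 0)" if "padic_Cauchy p X" for X
    using padic_Cauchy_uminus[OF p that] by (intro exI[of _ "\<lambda>n. - X n"]) auto
  thus "abelian_group (padic_Cauchy_ring p)"
    by (intro abelian_groupI) (auto simp: padic_Cauchy_const padic_Cauchy_add[OF p] algebra_simps)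
  show "comm_monoid (padic_Cauchy_ring p)"
    by (intro comm_monoidI) (auto simp: padic_Cauchy_const padic_Cauchy_mult[OF p] algebra_simps)
qed (auto simp: algebra_simps)

lemma padic_nullD: "X \<in> padic_null p \<Longrightarrow> e > 0 \<Longrightarrow> \<exists>N. \<forall>n\<ge>N. padic_abs p (X n) < e"
  by (simp add: padic_null_def)

lemma padic_null_add:
  assumes p: "prime p" and X: "X \<in> padic_null p" and Y: "Y \<in> padic_null p"
  shows "(\<lambda>n. X n + Y n) \<in> padic_null p"
  unfolding padic_null_def
proof (intro CollectI allI impI)
  fix e :: real assume e: "e > 0"
  obtain M where M: "\<forall>n\<ge>M. padic_abs p (X n) < e" using padic_nullD[OF X e] by blast
  obtain N where N: "\<forall>n\<ge>N. padic_abs p (Y n) < e" using padic_nullD[OF Y e] by blast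
  show "\<exists>N. \<forall>n\<ge>N. padic_abs p (X n + Y n) < e"
    using padic_abs_add_less[OF p] M N by (intro exI[of _ "max M N"]) auto
qed

lemma padic_null_mult:
  assumes p: "prime p" and X: "X \<in> padic_null p" and Y: "padic_Cauchy p Y"
  shows "(\<lambda>n. Y n * X n) \<in> padic_null p"
  unfolding padic_null_def
proof (intro CollectI allI impI)
  fix e :: real assume e: "e > 0"
  obtain B where B: "B > 0" "\<And>n. padic_abs p (Y n) \<le> B" using padic_Cauchy_bounded[OF p Y] by blast
  have "e / B > 0" using e B by simp
  then obtain N where N: "\<forall>n\<ge>N. padic_abs p (X n) < e / B" using padic_nullD[OF X] by blast
  have "padic_abs p (Y n * X n) < e" if "n \<ge> N" for n
  proof -
    have "padic_abs p (Y n * X n) \<le> B * padic_abs p (X n)"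
      unfolding padic_abs_mult[OF p] by (intro mult_right_mono B padic_abs_nonneg)
    also have "\<dots> < e" using N that B by (simp add: field_simps)
    finally show ?thesis .
  qed
  thus "\<exists>N. \<forall>n\<ge>N. padic_abs p (Y n * X n) < e" by blast
qed

lemma padic_null_Cauchy:
  assumes p: "prime p" and X: "X \<in> padic_null p"
  shows "padic_Cauchy p X"
  unfolding padic_Cauchy_def
proof (intro allI impI)
  fix e :: real assume "e > 0"
  then obtain N where N: "\<forall>n\<ge>N. padic_abs p (X n) < e" using padic_nullD[OF X] by blast
  thus "\<exists>N. \<forall>m\<ge>N. \<forall>n\<ge>N. padic_abs p (X m - X n) < e"
    using padic_abs_add_less[OF p, of "X _" e "- X _"] padic_abs_minus[OF p]
    by (intro exI[of _ N]) auto
qed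

lemma padic_null_ideal:
  assumes p: "prime p"
  shows "ideal (padic_null p) (padic_Cauchy_ring p)"
proof -
  interpret cring "padic_Cauchy_ring p" by (rule padic_Cauchy_ring_cring[OF p])
  have minus: "\<ominus>\<^bsub>padic_Cauchy_ring p\<^esub> X = (\<lambda>n. - X n)" if "padic_Cauchy p X" for X
    using that padic_Cauchy_uminus[OF p that] by (intro sum_zero_eq_neg[symmetric]) auto
  have neg: "(\<lambda>n. - X n) \<in> padic_null p" if "X \<in> padic_null p" for X
    using that padic_abs_minus[OF p] by (simp add: padic_null_def)
  have "(\<lambda>n. 0) \<in> padic_null p" by (simp add: padic_null_def)
  hence "subgroup (padic_null p) (add_monoid (padic_Cauchy_ring p))"
    using minus neg
    by (intro add.subgroupI) (auto simp: padic_null_Cauchy[OF p] padic_null_add[OF p])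
  thus ?thesis
    using padic_null_mult[OF p] by (intro idealI ring_axioms) (auto simp: mult.commute)
qed

lemma padic_Cauchy_inverse:
  assumes p: "prime p" and X: "padic_Cauchy p X" and nn: "X \<notin> padic_null p"
  shows "padic_Cauchy p (\<lambda>n. inverse (X n))" "\<exists>N. \<forall>n\<ge>N. X n \<noteq> 0"
proof -
  obtain e where e: "e > 0" "\<forall>N. \<exists>n\<ge>N. padic_abs p (X n) \<ge> e"
    using nn unfolding padic_null_def by (auto simp: not_less)
  obtain M where M: "\<forall>m\<ge>M. \<forall>n\<ge>M. padic_abs p (X m - X n) < e"
    using X e unfolding padic_Cauchy_def by blast
  have ge: "padic_abs p (X n) \<ge> e" if n: "n \<ge> M" for n
  proof (rule ccontr)
    assume a: "\<not> e \<le> padic_abs p (X n)"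
    obtain m where m: "m \<ge> M" "padic_abs p (X m) \<ge> e" using e by blast
    have "padic_abs p (X m - X n + X n) < e"
      using M m n a by (intro padic_abs_add_less[OF p]) auto
    thus False using m by simp
  qed
  have nz: "X n \<noteq> 0" if "n \<ge> M" for n using ge[OF that] e by auto
  thus "\<exists>N. \<forall>n\<ge>N. X n \<noteq> 0" by blast
  show "padic_Cauchy p (\<lambda>n. inverse (X n))"
    unfolding padic_Cauchy_def
  proof (intro allI impI)
    fix d :: real assume d: "d > 0"
    hence "d * (e * e) > 0" using e by simp
    then obtain N where N: "\<forall>m\<ge>N. \<forall>n\<ge>N. padic_abs p (X m - X n) < d * (e * e)"
      using X unfolding padic_Cauchy_def by blast
    have "padic_abs p (inverse (X m) - inverse (X n)) < d" if mn: "m \<ge> max M N" "n \<ge> max M N" for m n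
    proof -
      have z: "X m \<noteq> 0" "X n \<noteq> 0" using nz mn by auto
      have "X n - X m = (inverse (X m) - inverse (X n)) * (X m * X n)"
        using z by (simp add: field_simps)
      hence "padic_abs p (X n - X m) =
          padic_abs p (inverse (X m) - inverse (X n)) * (padic_abs p (X m) * padic_abs p (X n))"
        by (simp add: padic_abs_mult[OF p])
      moreover have "e * e \<le> padic_abs p (X m) * padic_abs p (X n)"
        using ge mn e by (intro mult_mono padic_abs_nonneg) auto
      ultimately have "padic_abs p (inverse (X m) - inverse (X n)) * (e * e) \<le> padic_abs p (X n - X m)"
        by (simp add: mult_left_mono padic_abs_nonneg)
      also have "\<dots> < d * (e * e)" using N mn by auto
      finally show ?thesis using e by (simp add: mult_less_cancel_right)
    qed
    thus "\<exists>N. \<forall>m\<ge>N. \<forall>n\<ge>N. padic_abs p (inverse (X m) - inverse (X n)) < d" by blast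
  qed
qed

lemma padic_field_carrier:
  "carrier (padic_field p) = {padic_null p +>\<^bsub>padic_Cauchy_ring p\<^esub> X | X. padic_Cauchy p X}"
  by (auto simp: padic_field_def FactRing_def A_RCOSETS_def' a_r_coset_def')

theorem padic_field_field:
  assumes p: "prime p"
  shows "field (padic_field p)"
proof -
  interpret ideal "padic_null p" "padic_Cauchy_ring p" by (rule padic_null_ideal[OF p])
  interpret C: cring "padic_Cauchy_ring p" by (rule padic_Cauchy_ring_cring[OF p])
  interpret Q: cring "padic_field p"
    unfolding padic_field_def by (rule quotient_is_cring) (rule C.is_cring)
  let ?R = "padic_Cauchy_ring p" and ?I = "padic_null p"
  have one_notin: "(\<lambda>n. 1) \<notin> ?I"
    using padic_nullD[of "\<lambda>n. 1" p 1] padic_abs_1[OF p] by auto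
  show ?thesis
  proof (rule Q.cring_fieldI2)
    show "\<zero>\<^bsub>padic_field p\<^esub> \<noteq> \<one>\<^bsub>padic_field p\<^esub>"
      using one_notin rcos_const_imp_mem[of "\<lambda>n. 1"]
      by (auto simp: padic_field_def FactRing_def padic_Cauchy_const)
  next
    fix a assume a: "a \<in> carrier (padic_field p)" "a \<noteq> \<zero>\<^bsub>padic_field p\<^esub>"
    then obtain X where X: "padic_Cauchy p X" "a = ?I +>\<^bsub>?R\<^esub> X"
      by (auto simp: padic_field_carrier)
    have "X \<notin> ?I" using a X a_rcos_zero[of ?I X] is_ideal
      by (auto simp: padic_field_def FactRing_def)
    note Y = padic_Cauchy_inverse[OF p X(1) this]
    obtain N where N: "\<forall>n\<ge>N. X n \<noteq> 0" using Y(2) by blast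
    let ?Y = "\<lambda>n. inverse (X n)"
    have "(\<lambda>n. X n * ?Y n - 1) \<in> ?I"
      unfolding padic_null_def using N by (auto intro!: exI[of _ N])
    moreover have "(\<lambda>n. X n * ?Y n) = (\<lambda>n. X n * ?Y n - 1) \<oplus>\<^bsub>?R\<^esub> (\<lambda>n. 1)" by simp
    ultimately have "(\<lambda>n. X n * ?Y n) \<in> ?I +>\<^bsub>?R\<^esub> (\<lambda>n. 1)"
      unfolding a_r_coset_def' by blast
    hence "?I +>\<^bsub>?R\<^esub> (\<lambda>n. X n * ?Y n) = ?I +>\<^bsub>?R\<^esub> (\<lambda>n. 1)"
      using a_repr_independence' by (simp add: padic_Cauchy_const)
    hence "a \<otimes>\<^bsub>padic_field p\<^esub> (?I +>\<^bsub>?R\<^esub> ?Y) = \<one>\<^bsub>padic_field p\<^esub>"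
      using X Y(1) rcoset_mult_add[of X ?Y] by (simp add: padic_field_def FactRing_def)
    moreover have "?I +>\<^bsub>?R\<^esub> ?Y \<in> carrier (padic_field p)"
      using Y(1) by (auto simp: padic_field_carrier)
    ultimately show "\<exists>b\<in>carrier (padic_field p). a \<otimes>\<^bsub>padic_field p\<^esub> b = \<one>\<^bsub>padic_field p\<^esub>"
      by blast
  qed
qed

lemma padic_of_rat_carrier: "padic_of_rat p q \<in> carrier (padic_field p)"
  using padic_Cauchy_const[of p q] by (auto simp: padic_of_rat_def padic_field_carrier)

lemma padic_of_rat_eq_zero_iff:
  assumes p: "prime p"
  shows "padic_of_rat p q = \<zero>\<^bsub>padic_field p\<^esub> \<longleftrightarrow> q = 0"
proof -
  interpret ideal "padic_null p" "padic_Cauchy_ring p" by (rule padic_null_ideal[OF p])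
  have "padic_of_rat p q = padic_null p \<longleftrightarrow> (\<lambda>n. q) \<in> padic_null p"
    using rcos_const_imp_mem[of "\<lambda>n. q"] a_rcos_zero[OF is_ideal, of "\<lambda>n. q"]
    by (auto simp: padic_of_rat_def padic_Cauchy_const)
  also have "\<dots> \<longleftrightarrow> q = 0"
    using padic_abs_pos[OF p, of q] by (auto simp: padic_null_def)
  finally show ?thesis by (simp add: padic_field_def FactRing_def)
qed

end

(*
  For a symbol h, write T(u1, u2, u3) = h(-u1 u3, -u2 u3). If h is the Hilbert symbol at p, this
  records whether the form u1 x^2 + u2 y^2 + u3 z^2 is isotropic over Q_p, and it is the symbol in
  question because -u1/u3 and -u1 u3 agree up to squares. By quadratic reciprocity the product of T
  over all places is 1, so it suffices that T is trivial at infinity, at 2, and at the odd primes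
  not dividing n. At infinity this holds because the u_i do not all have the same sign. At a prime p
  not dividing n, clearing denominators gives n (u1 u2 + u1 u3 + u2 u3) = 4 u1 u2 u3, which forces
  the largest p-adic valuation to be attained twice, say by u2 and u3. For odd p, either all three
  valuations agree, or -u2/u3 is congruent to 1 modulo p and hence a square; for p = 2 the equation
  becomes a congruence modulo 8 between the unit parts, from which T is computed.

  Only at odd p is the actual Hilbert symbol needed; the symbol at 2 enters solely through
  its explicit formula, so no 2-adic analysis occurs.
*)
theory Submission
  imports Defs "HOL-Number_Theory.Quadratic_Reciprocity"
begin

subsection \<open>The Legendre symbol\<close>

lemma Legendre_sign: "\<not> p dvd a \<Longrightarrow> Legendre a p = 1 \<or> Legendre a p = -1"
  by (simp add: Legendre_def cong_0_iff)

lemma Legendre_eq_1_iff: "\<not> p dvd a \<Longrightarrow> Legendre a p = 1 \<longleftrightarrow> QuadRes p a"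
  by (simp add: Legendre_def cong_0_iff)

lemma sign_power: "(x::int) = 1 \<or> x = -1 \<Longrightarrow> x ^ n = 1 \<or> x ^ n = -1"
  by (cases "even n") auto

lemma sign_mult:
  "(x::int) = 1 \<or> x = -1 \<Longrightarrow> y = 1 \<or> y = -1 \<Longrightarrow> x * y = 1 \<or> x * y = -1"
  by auto

text \<open>Two signs differ by at most 2, so a modulus above 2 separates them. This turns
  congruences from Euler's criterion into equalities of symbols.\<close>

lemma sign_cong_eq:
  fixes a b p :: int
  assumes "p > 2" "[a = b] (mod p)" "a = 1 \<or> a = -1" "b = 1 \<or> b = -1"
  shows "a = b"
proof -
  have "p dvd a - b" using assms(2) by (simp add: cong_iff_dvd_diff)
  hence "a - b = 0 \<or> p \<le> \<bar>a - b\<bar>" using dvd_imp_le_int[of "a - b" p] assms(1) by auto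
  thus ?thesis using assms by auto
qed

text \<open>Euler's criterion replaces each symbol by a power with exponent (p - 1)/2, and powers
  are multiplicative; the two sides are then congruent signs.\<close>

lemma Legendre_mult:
  assumes p: "prime p" "2 < p" and ab: "\<not> int p dvd a" "\<not> int p dvd b"
  shows "Legendre (a * b) (int p) = Legendre a (int p) * Legendre b (int p)"
proof (rule sign_cong_eq[of "int p"])
  let ?k = "(p - 1) div 2"
  have nd: "\<not> int p dvd a * b" using p ab by (simp add: prime_dvd_mult_iff)
  have "[Legendre (a * b) (int p) = (a * b) ^ ?k] (mod int p)" by (rule euler_criterion[OF p])
  moreover have "[Legendre a (int p) * Legendre b (int p) = a ^ ?k * b ^ ?k] (mod int p)"
    by (intro cong_mult euler_criterion[OF p])
  ultimately show "[Legendre (a * b) (int p) = Legendre a (int p) * Legendre b (int p)] (mod int p)"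
    unfolding power_mult_distrib by (meson cong_sym cong_trans)
  show "Legendre (a * b) (int p) = 1 \<or> Legendre (a * b) (int p) = -1" by (rule Legendre_sign[OF nd])
  show "Legendre a (int p) * Legendre b (int p) = 1 \<or> Legendre a (int p) * Legendre b (int p) = -1"
    using Legendre_sign[OF ab(1)] Legendre_sign[OF ab(2)] by auto
qed (use p in auto)

lemma Legendre_square: "\<not> int p dvd a \<Longrightarrow> prime p \<Longrightarrow> Legendre (a ^ 2) (int p) = 1"
  by (subst Legendre_eq_1_iff) (auto simp: QuadRes_def prime_dvd_power_iff intro!: exI[of _ a])

lemma Legendre_minus_one:
  assumes p: "prime p" "2 < p"
  shows "Legendre (-1) (int p) = (if int p mod 4 = 3 then -1 else 1)"
proof (rule sign_cong_eq[of "int p"])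
  have "odd p" using p prime_odd_nat by blast
  hence "(-1::int) ^ ((p - 1) div 2) = (if int p mod 4 = 3 then -1 else 1)"
    by (auto simp: minus_one_power_iff; presburger)
  thus "[Legendre (-1) (int p) = (if int p mod 4 = 3 then -1 else 1)] (mod int p)"
    using euler_criterion[OF p, of "-1"] by simp
  show "Legendre (-1) (int p) = 1 \<or> Legendre (-1) (int p) = -1"
    by (rule Legendre_sign) (use p in auto)
qed (use p in auto)

text \<open>Gauss's lemma: the sign is the parity of the number of doubles 2y, with 1 \<le> y \<le>
  h = (p - 1)/2, that exceed h.\<close>

lemma Legendre_two:
  assumes p: "prime p" "2 < p"
  shows "Legendre 2 (int p) = (if int p mod 8 \<in> {1, 7} then 1 else -1)"
proof -
  have np: "\<not> int p dvd 2" using p zdvd_not_zless[of 2 "int p"] by auto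
  interpret GAUSS p 2
    by unfold_locales (use p np in \<open>auto simp: cong_0_iff\<close>)
  define h where "h = (int p - 1) div 2"
  have h: "int p = 2 * h + 1" unfolding h_def by (rule p_eq2)
  \<comment> \<open>The doubles stay below p, so reduction modulo p changes nothing, and 2y > h
    exactly when y > h div 2.\<close>
  have "E = (\<lambda>y. 2 * y) ` {h div 2 + 1..h}"
  proof -
    have C: "C = (\<lambda>y. 2 * y) ` {1..h}"
      unfolding C_def B_def A_def image_image h_def[symmetric]
      by (rule image_cong) (use h in auto)
    show ?thesis unfolding E_def C h_def[symmetric] by auto
  qed
  hence "card E = nat (h - h div 2)"
    by (simp add: card_image inj_on_def)
  hence "Legendre 2 (int p) = (-1) ^ nat (h - h div 2)" using gauss_lemma by simp
  moreover have "even (nat (h - h div 2)) \<longleftrightarrow> even (h - h div 2)"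
    using h p by (subst even_nat_iff) auto
  moreover have "even (h - h div 2) \<longleftrightarrow> int p mod 8 \<in> {1, 7}"
  proof -
    \<comment> \<open>The parity depends only on h mod 4, which carries the same information as p
      mod 8 because p = 2h + 1.\<close>
    define q r where "q = h div 4" and "r = h mod 4"
    have hq: "h = 4 * q + r" by (simp add: q_def r_def)
    have r: "r \<in> {0, 1, 2, 3}" unfolding r_def by simp presburger
    have "int p = 8 * q + (2 * r + 1)" using h hq by simp
    hence "int p mod 8 = (2 * r + 1) mod 8" by simp
    moreover have "h div 2 = 2 * q + r div 2" using hq by auto
    ultimately show ?thesis using r hq by auto
  qed
  ultimately show ?thesis by (simp add: minus_one_power_iff)
qed

subsection \<open>Explicit local symbols and the product formula\<close>

definition unit_part :: "int \<Rightarrow> int \<Rightarrow> int" where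
  "unit_part p a = a div p ^ multiplicity p a"

lemma unit_part_decompose: "a = p ^ multiplicity p a * unit_part p a"
  by (simp add: unit_part_def multiplicity_dvd)

lemma unit_part_not_dvd: "a \<noteq> 0 \<Longrightarrow> prime p \<Longrightarrow> \<not> p dvd unit_part p a"
  unfolding unit_part_def by (rule multiplicity_decompose) auto

lemma multiplicity_power_times:
  fixes p :: int
  assumes "prime p" "\<not> p dvd w"
  shows "multiplicity p (p ^ k * w) = k"
  by (rule multiplicity_eqI) (use assms in auto)

lemma unit_part_power_times:
  assumes "prime p" "\<not> p dvd w"
  shows "unit_part p (p ^ k * w) = w"
  using assms by (simp add: unit_part_def multiplicity_power_times prime_gt_0_int)

lemma unit_part_mult:
  assumes "prime p" "a \<noteq> 0" "b \<noteq> 0"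
  shows "unit_part p (a * b) = unit_part p a * unit_part p b"
proof -
  have "a * b = p ^ (multiplicity p a + multiplicity p b) * (unit_part p a * unit_part p b)"
    using unit_part_decompose[of a p] unit_part_decompose[of b p]
    by (metis (no_types, opaque_lifting) mult.assoc mult.left_commute power_add)
  moreover have "\<not> p dvd unit_part p a * unit_part p b"
    using assms unit_part_not_dvd by (simp add: prime_dvd_mult_iff)
  ultimately show ?thesis using unit_part_power_times assms(1) by metis
qed

lemma unit_part_eq_self: "\<not> p dvd a \<Longrightarrow> unit_part p a = a"
  by (simp add: unit_part_def not_dvd_imp_multiplicity_0)

lemma unit_part_self: "prime p \<Longrightarrow> unit_part p p = 1"
  using unit_part_power_times[of p 1 1] by auto

lemma multiplicity_minus_int: "multiplicity p (- a) = multiplicity p (a::int)"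
  by (simp add: multiplicity_def)

lemma unit_part_minus: "unit_part p (- a) = - unit_part p a"
  by (simp add: unit_part_def multiplicity_minus_int multiplicity_dvd dvd_neg_div)

section \<open>Closed formulas at odd primes, at 2 and at the real place\<close>

text \<open>With a = p^v u and b = p^w u', this is the Legendre symbol of the tame residue (-1)^(vw)
  u^w / u'^v; division becomes multiplication because the values are signs.\<close>

definition tame_symbol :: "nat \<Rightarrow> int \<Rightarrow> int \<Rightarrow> int" where
  "tame_symbol p a b =
     Legendre (-1) (int p) ^ (multiplicity (int p) a * multiplicity (int p) b) *
     Legendre (unit_part (int p) a) (int p) ^ multiplicity (int p) b *
     Legendre (unit_part (int p) b) (int p) ^ multiplicity (int p) a"

text \<open>On odd arguments this is -1 to the power ((u - 1)/2)((v - 1)/2), the sign in quadratic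
  reciprocity.\<close>

definition odd_sign4 :: "int \<Rightarrow> int \<Rightarrow> int" where
  "odd_sign4 u v = (if u mod 4 = 3 \<and> v mod 4 = 3 then -1 else 1)"

text \<open>On odd u this is -1 to the power (u^2 - 1)/8.\<close>

definition odd_sign8 :: "int \<Rightarrow> int" where
  "odd_sign8 u = (if u mod 8 \<in> {1, 7} then 1 else -1)"

text \<open>For nonzero arguments, the classical closed form of the Hilbert symbol over Q_2, taken
  as the definition.\<close>

definition dyadic_symbol :: "int \<Rightarrow> int \<Rightarrow> int" where
  "dyadic_symbol a b =
     odd_sign4 (unit_part 2 a) (unit_part 2 b) *
     odd_sign8 (unit_part 2 a) ^ multiplicity 2 b *
     odd_sign8 (unit_part 2 b) ^ multiplicity 2 a"

text \<open>For nonzero arguments, the Hilbert symbol over the reals: z^2 = a x^2 + b y^2 has only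
  the zero solution exactly when both coefficients are negative.\<close>

definition real_symbol :: "int \<Rightarrow> int \<Rightarrow> int" where
  "real_symbol a b = (if a < 0 \<and> b < 0 then -1 else 1)"

section \<open>Bimultiplicative sign-valued symbols\<close>

text \<open>These axioms are stable under products, so the product of all local symbols can be
  handled as one symbol.\<close>

locale sign_symbol =
  fixes h :: "int \<Rightarrow> int \<Rightarrow> int"
  assumes sign: "a \<noteq> 0 \<Longrightarrow> b \<noteq> 0 \<Longrightarrow> h a b = 1 \<or> h a b = -1"
    and commute: "h a b = h b a"
    and mult_left: "a \<noteq> 0 \<Longrightarrow> b \<noteq> 0 \<Longrightarrow> c \<noteq> 0 \<Longrightarrow> h (a * b) c = h a c * h b c"
begin

lemma mult_right: "a \<noteq> 0 \<Longrightarrow> b \<noteq> 0 \<Longrightarrow> c \<noteq> 0 \<Longrightarrow> h a (b * c) = h a b * h a c"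
  by (metis commute mult_left)

lemma square_eq_1: "a \<noteq> 0 \<Longrightarrow> b \<noteq> 0 \<Longrightarrow> h a b * h a b = 1"
  using sign[of a b] by auto

lemma one_left: "b \<noteq> 0 \<Longrightarrow> h 1 b = 1"
  using mult_left[of 1 1 b] sign[of 1 b] by auto

text \<open>A nonzero integer is a unit times primes, so bimultiplicativity reduces one argument
  after the other to -1 and primes in \<open>S\<close>.\<close>

lemma trivial_if_trivial_on_generators:
  assumes S: "\<And>p. p \<in> S \<Longrightarrow> prime p"
    and gen: "\<And>q r. q \<in> insert (-1) (int ` S) \<Longrightarrow> r \<in> insert (-1) (int ` S) \<Longrightarrow> h q r = 1"
    and ab: "a \<noteq> 0" "b \<noteq> 0"
    and div: "\<And>p. prime p \<Longrightarrow> int p dvd a * b \<Longrightarrow> p \<in> S"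
  shows "h a b = 1"
proof -
  have S0: "0 \<notin> S" using S[of 0] by auto
  \<comment> \<open>Reduction of the first argument with the second one fixed. It is applied to
    \<open>b\<close> against each generator and, after commuting, to \<open>a\<close> against
    \<open>b\<close>.\<close>
  have ind: "h x c = 1"
    if "x \<noteq> 0" "\<And>q. q \<in> insert (-1) (int ` S) \<Longrightarrow> h q c = 1"
      "\<And>p. prime p \<Longrightarrow> int p dvd x \<Longrightarrow> p \<in> S" "c \<noteq> 0" for x c
    using that
  proof (induction x rule: prime_divisors_induct)
    case (unit x)
    have "x = 1 \<or> x = -1" using unit.hyps by auto
    thus ?case using one_left unit.prems by auto
  next
    case (factor q x)
    have q: "q \<in> int ` S"
      using factor.hyps factor.prems(3)[of "nat q"] prime_gt_0_int[of q]
      by (auto intro!: image_eqI[of _ _ "nat q"])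
    have "h x c = 1" using factor by auto
    thus ?case using mult_left[of q x c] factor.prems q by auto
  qed simp
  show ?thesis
  proof (rule ind)
    fix q assume q: "q \<in> insert (-1) (int ` S)"
    have "h b q = 1"
      by (rule ind) (use ab div gen q S0 in auto)
    thus "h q b = 1" by (simp add: commute)
  qed (use ab div in auto)
qed

end

lemma sign_symbol_times:
  assumes "sign_symbol f" "sign_symbol g"
  shows "sign_symbol (\<lambda>a b. f a b * g a b)"
proof -
  interpret f: sign_symbol f by fact
  interpret g: sign_symbol g by fact
  show ?thesis
  proof
    show "f a b * g a b = 1 \<or> f a b * g a b = -1" if "a \<noteq> 0" "b \<noteq> 0" for a b
      using f.sign[OF that] g.sign[OF that] by auto
    show "f a b * g a b = f b a * g b a" for a b
      using f.commute[of a b] g.commute[of a b] by simp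
  qed (simp add: f.mult_left g.mult_left)
qed

lemma sign_symbol_prod:
  assumes "\<And>i. i \<in> I \<Longrightarrow> sign_symbol (f i)"
  shows "sign_symbol (\<lambda>a b. \<Prod>i\<in>I. f i a b)"
  using assms
proof (induction I rule: infinite_finite_induct)
  case (insert i I)
  hence "sign_symbol (\<lambda>a b. f i a b * (\<Prod>i\<in>I. f i a b))"
    by (intro sign_symbol_times) auto
  thus ?case using insert by simp
qed (simp_all add: sign_symbol_def)

section \<open>Symbols of diagonal ternary forms\<close>

definition ternary_symbol :: "(int \<Rightarrow> int \<Rightarrow> int) \<Rightarrow> int \<Rightarrow> int \<Rightarrow> int \<Rightarrow> int" where
  "ternary_symbol h u1 u2 u3 = h (- (u1 * u3)) (- (u2 * u3))"

text \<open>The Steinberg relation makes the symbol of the diagonal form with coefficients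
  \<open>u\<^sub>1, u\<^sub>2, u\<^sub>3\<close> independent of the order of the coefficients.\<close>

locale steinberg_symbol = sign_symbol +
  assumes neg: "a \<noteq> 0 \<Longrightarrow> h a (- a) = 1"
begin

lemma ternary_swap12: "ternary_symbol h u1 u2 u3 = ternary_symbol h u2 u1 u3"
  by (simp add: ternary_symbol_def commute)

text \<open>Both symbols have x = -u1 u3 as first argument, and their product is h x (-x u2^2),
  which is trivial by the Steinberg relation. Two integers with product 1 are equal.\<close>

lemma ternary_swap13:
  assumes "u1 \<noteq> 0" "u2 \<noteq> 0" "u3 \<noteq> 0"
  shows "ternary_symbol h u1 u2 u3 = ternary_symbol h u3 u2 u1"
proof -
  define x where "x = - (u1 * u3)"
  have x: "x \<noteq> 0" using assms by (simp add: x_def)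
  have "h x (- (u2 * u3)) * h x (- (u2 * u1)) = h x ((- (u2 * u3)) * (- (u2 * u1)))"
    by (rule mult_right[symmetric]) (use assms x in auto)
  also have "(- (u2 * u3)) * (- (u2 * u1)) = (- x) * (u2 * u2)"
    by (simp add: x_def mult_ac)
  also have "h x \<dots> = 1"
    using assms x neg[OF x] square_eq_1[of x u2] mult_right[of x "-x" "u2 * u2"] mult_right[of x u2 u2] by simp
  finally have "ternary_symbol h u1 u2 u3 * ternary_symbol h u3 u2 u1 = 1"
    by (simp add: ternary_symbol_def x_def mult.commute[of u3 u1])
  thus ?thesis
    using zmult_eq_1_iff[of "ternary_symbol h u1 u2 u3"] by auto
qed

text \<open>Two transpositions generate all permutations, so a symmetric condition \<open>Q\<close>
  allows the coefficients to be ordered by \<open>f\<close>, which is a valuation in the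
  applications.\<close>

lemma ternary_symbol_eq_1_by_sorting:
  fixes f :: "int \<Rightarrow> nat"
  assumes sorted: "\<And>a b c. Q a b c \<Longrightarrow> f a \<le> f b \<Longrightarrow> f b \<le> f c \<Longrightarrow> ternary_symbol h a b c = 1"
    and Q: "\<And>a b c. Q a b c \<Longrightarrow> Q b a c \<and> Q c b a \<and> a \<noteq> 0 \<and> b \<noteq> 0 \<and> c \<noteq> 0"
    and "Q a b c"
  shows "ternary_symbol h a b c = 1"
proof -
  have swaps: "ternary_symbol h a b c = ternary_symbol h b a c \<and> ternary_symbol h a b c = ternary_symbol h c b a"
    if "Q a b c" for a b c
    using ternary_swap12 ternary_swap13 Q[OF that] by auto
  consider "f a \<le> f b \<and> f b \<le> f c" | "f a \<le> f c \<and> f c \<le> f b" | "f b \<le> f a \<and> f a \<le> f c"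
    | "f b \<le> f c \<and> f c \<le> f a" | "f c \<le> f a \<and> f a \<le> f b" | "f c \<le> f b \<and> f b \<le> f a"
    by linarith
  thus ?thesis
    using sorted swaps Q \<open>Q a b c\<close> by cases metis+
qed

end

section \<open>Symbol axioms for the closed formulas\<close>

lemma steinberg_symbol_tame:
  assumes p: "prime p" "2 < p"
  shows "steinberg_symbol (tame_symbol p)"
proof
  let ?L = "\<lambda>x. Legendre x (int p)"
  have P: "prime (int p)" using p by simp
  have L1: "?L (-1) = 1 \<or> ?L (-1) = -1" using P by (intro Legendre_sign) auto
  have L: "?L (unit_part (int p) a) = 1 \<or> ?L (unit_part (int p) a) = -1" if "a \<noteq> 0" for a
    using unit_part_not_dvd[OF that P] by (rule Legendre_sign)
  show "tame_symbol p a b = 1 \<or> tame_symbol p a b = -1" if "a \<noteq> 0" "b \<noteq> 0" for a b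
    unfolding tame_symbol_def
    by (intro sign_mult sign_power L1 L that)
  show "tame_symbol p a b = tame_symbol p b a" for a b
    by (simp add: tame_symbol_def mult_ac)
  show "tame_symbol p (a * b) c = tame_symbol p a c * tame_symbol p b c"
    if "a \<noteq> 0" "b \<noteq> 0" "c \<noteq> 0" for a b c
    using that P unit_part_not_dvd[OF _ P]
    by (simp add: tame_symbol_def unit_part_mult prime_elem_multiplicity_mult_distrib
        Legendre_mult[OF p] power_add power_mult_distrib algebra_simps)
  show "tame_symbol p a (- a) = 1" if a: "a \<noteq> 0" for a
  proof -
    let ?v = "multiplicity (int p) a" and ?u = "unit_part (int p) a"
    have "?L (- ?u) = ?L (-1) * ?L ?u"
      using Legendre_mult[OF p, of "-1" ?u] unit_part_not_dvd[OF a P] p by auto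
    \<comment> \<open>Both arguments have valuation v. The sign of -1 occurs v^2 times from the
      mixed factor and v times from the unit part -u; the total v^2 + v is even.\<close>
    hence "tame_symbol p a (- a) = ?L (-1) ^ (?v * ?v + ?v) * (?L ?u * ?L ?u) ^ ?v"
      by (simp add: tame_symbol_def unit_part_minus multiplicity_minus_int
          power_add power_mult_distrib)
    also have "?L ?u * ?L ?u = 1" using L[OF a] by auto
    also have "?L (-1) ^ (?v * ?v + ?v) = 1"
      using L1 by (auto simp: minus_one_power_iff)
    finally show ?thesis by simp
  qed
qed

lemma odd_sign8_sign: "odd_sign8 u = 1 \<or> odd_sign8 u = -1"
  by (simp add: odd_sign8_def)

lemma odd_mod8: "odd (a::int) \<Longrightarrow> a mod 8 \<in> {1, 3, 5, 7}"
  by simp presburger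

lemma odd_mod4: "odd (a::int) \<Longrightarrow> a mod 4 \<in> {1, 3}"
  by simp presburger

lemma odd_sign8_cong: "a mod 8 = b mod 8 \<Longrightarrow> odd_sign8 a = odd_sign8 b"
  by (simp add: odd_sign8_def)

lemma odd_sign4_cong:
  "a mod 4 = b mod 4 \<Longrightarrow> c mod 4 = d mod 4 \<Longrightarrow> odd_sign4 a c = odd_sign4 b d"
  by (simp add: odd_sign4_def)

text \<open>A finite check on the residues 1, 3, 5, 7, carried to all odd integers by periodicity
  modulo 8.\<close>

lemma odd_sign8_mult:
  assumes "odd a" "odd b"
  shows "odd_sign8 (a * b) = odd_sign8 a * odd_sign8 b"
proof -
  have "odd_sign8 (x * y) = odd_sign8 x * odd_sign8 y"
    if "x \<in> {1, 3, 5, 7}" "y \<in> {1, 3, 5, 7}" for x y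
    using that by (auto simp: odd_sign8_def)
  from this[OF odd_mod8 odd_mod8, OF assms] show ?thesis
    using odd_sign8_cong[of "a mod 8 * (b mod 8)" "a * b"] odd_sign8_cong[of "a mod 8" a]
      odd_sign8_cong[of "b mod 8" b] by (simp add: mod_mult_eq)
qed

lemma odd_sign4_mult:
  assumes "odd a" "odd b"
  shows "odd_sign4 (a * b) c = odd_sign4 a c * odd_sign4 b c"
proof -
  have "odd_sign4 (x * y) c = odd_sign4 x c * odd_sign4 y c"
    if "x \<in> {1, 3}" "y \<in> {1, 3}" for x y
    using that by (auto simp: odd_sign4_def)
  from this[OF odd_mod4 odd_mod4, OF assms] show ?thesis
    using odd_sign4_cong[of "a mod 4 * (b mod 4)" "a * b" c c]
      odd_sign4_cong[of "a mod 4" a c c] odd_sign4_cong[of "b mod 4" b c c] by (simp add: mod_mult_eq)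
qed

lemma steinberg_symbol_dyadic: "steinberg_symbol dyadic_symbol"
proof
  have odd: "odd (unit_part 2 a)" if "a \<noteq> 0" for a :: int
    using unit_part_not_dvd[OF that, of 2] by simp
  show "dyadic_symbol a b = 1 \<or> dyadic_symbol a b = -1" for a b
    unfolding dyadic_symbol_def
    by (intro sign_mult sign_power odd_sign8_sign) (simp add: odd_sign4_def)
  show "dyadic_symbol a b = dyadic_symbol b a" for a b
    by (auto simp: dyadic_symbol_def odd_sign4_def)
  show "dyadic_symbol (a * b) c = dyadic_symbol a c * dyadic_symbol b c"
    if "a \<noteq> 0" "b \<noteq> 0" "c \<noteq> 0" for a b c
    using that odd
    by (simp add: dyadic_symbol_def unit_part_mult prime_elem_multiplicity_mult_distrib
        odd_sign8_mult odd_sign4_mult power_add power_mult_distrib)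
  show "dyadic_symbol a (- a) = 1" if a: "a \<noteq> 0" for a
  proof -
    let ?u = "unit_part 2 a"
    \<comment> \<open>Exactly one of u and -u is 3 modulo 4, and negation exchanges 1 with 7 and 3
      with 5 modulo 8.\<close>
    have "odd_sign4 ?u (- ?u) = 1" "odd_sign8 (- ?u) = odd_sign8 ?u"
      using zmod_zminus1_eq_if[of ?u 8] zmod_zminus1_eq_if[of ?u 4] odd_mod8[OF odd[OF a]]
      by (auto simp: odd_sign4_def odd_sign8_def)
    moreover have "odd_sign8 ?u ^ k * odd_sign8 ?u ^ k = 1" for k
      using odd_sign8_sign[of ?u] by (auto simp flip: power_mult_distrib)
    ultimately show ?thesis
      by (simp add: dyadic_symbol_def unit_part_minus multiplicity_minus_int)
  qed
qed

lemma sign_symbol_real: "sign_symbol real_symbol"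
  by unfold_locales (auto simp: real_symbol_def mult_less_0_iff)

section \<open>Values on generators and the product formula\<close>

lemma tame_symbol_units:
  "\<not> int p dvd a \<Longrightarrow> \<not> int p dvd b \<Longrightarrow> tame_symbol p a b = 1"
  by (simp add: tame_symbol_def not_dvd_imp_multiplicity_0)

lemma tame_symbol_unit_prime:
  assumes "prime p" "\<not> int p dvd a"
  shows "tame_symbol p a (int p) = Legendre a (int p)"
proof -
  have "multiplicity (int p) (int p) = 1"
    using multiplicity_power_times[of "int p" 1 1] assms by auto
  thus ?thesis
    using assms by (simp add: tame_symbol_def not_dvd_imp_multiplicity_0 unit_part_eq_self)
qed

lemma tame_symbol_prime_prime:
  assumes "prime p"
  shows "tame_symbol p (int p) (int p) = Legendre (-1) (int p)"
proof -
  have "multiplicity (int p) (int p) = 1"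
    using multiplicity_power_times[of "int p" 1 1] assms by auto
  moreover have "Legendre 1 (int p) = 1"
    using Legendre_square[of p 1] assms by (cases "p = 1") auto
  ultimately show ?thesis
    using assms by (simp add: tame_symbol_def unit_part_self)
qed

lemma dyadic_symbol_odd: "odd a \<Longrightarrow> odd b \<Longrightarrow> dyadic_symbol a b = odd_sign4 a b"
  by (simp add: dyadic_symbol_def not_dvd_imp_multiplicity_0 unit_part_eq_self)

lemma dyadic_symbol_two: "odd b \<Longrightarrow> dyadic_symbol 2 b = odd_sign8 b"
  by (simp add: dyadic_symbol_def not_dvd_imp_multiplicity_0 unit_part_eq_self unit_part_self
      odd_sign4_def odd_sign8_def)

lemma dyadic_symbol_two_two: "dyadic_symbol 2 2 = 1"
  by (simp add: dyadic_symbol_def unit_part_self odd_sign4_def odd_sign8_def)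

text \<open>The full product is itself a sign symbol, so it suffices to test it on -1 and primes.
  Pairs with -1 give the first supplement to reciprocity, pairs with 2 the second, and two distinct
  odd primes the reciprocity law itself.\<close>

theorem product_formula:
  assumes S: "finite S" "\<And>p. p \<in> S \<Longrightarrow> prime p"
    and ab: "a \<noteq> 0" "b \<noteq> 0"
    and div: "\<And>p. prime p \<Longrightarrow> int p dvd a * b \<Longrightarrow> p \<in> S"
  shows "real_symbol a b * dyadic_symbol a b * (\<Prod>p\<in>S - {2}. tame_symbol p a b) = 1"
proof -
  define h where
    "h a b = real_symbol a b * dyadic_symbol a b * (\<Prod>p\<in>S - {2}. tame_symbol p a b)" for a b
  have gt2: "2 < p" if "p \<in> S - {2}" for p
    using that S(2)[of p] prime_ge_2_nat[of p] by auto
  interpret sign_symbol h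
    unfolding h_def
    by (intro sign_symbol_times sign_symbol_prod sign_symbol_real
        steinberg_symbol_dyadic[THEN steinberg_symbol.axioms(1)]
        steinberg_symbol_tame[THEN steinberg_symbol.axioms(1)]) (use S gt2 in auto)
  have nd: "\<not> int p dvd int q" if "p \<in> S" "q \<in> S" "p \<noteq> q" for p q
    using that S(2) primes_dvd_imp_eq[of p q] by auto
  have nd1: "\<not> int p dvd - 1" if "p \<in> S" for p
    using S(2)[OF that] by auto
  have odd: "odd q" if "q \<in> S - {2}" for q
    using S(2) gt2 that prime_odd_nat by blast
  \<comment> \<open>Tame factors at primes dividing neither argument are trivial; this isolates the
    single remaining factor, at \<open>q\<close>.\<close>
  have split: "(\<Prod>p\<in>S - {2}. f p) = f q" if "q \<in> S - {2}" "\<And>p. p \<in> S - {2} \<Longrightarrow> p \<noteq> q \<Longrightarrow> f p = 1"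
    for f :: "nat \<Rightarrow> int" and q
    using that S(1) by (subst prod.remove[of _ q]) (auto intro!: prod.neutral)
  \<comment> \<open>The real and the dyadic factor are both -1 here and cancel.\<close>
  have m1_m1: "h (-1) (-1) = 1"
    using nd1 by (simp add: h_def real_symbol_def dyadic_symbol_odd odd_sign4_def tame_symbol_units)
  have m1_q: "h (-1) (int q) = 1" if q: "q \<in> S" for q
  proof (cases "q = 2")
    case True
    have "(\<Prod>p\<in>S - {2}. tame_symbol p (-1) 2) = 1"
      using nd1 nd[of _ q] q True by (auto intro!: prod.neutral tame_symbol_units)
    thus ?thesis using True steinberg_symbol.axioms(1)[OF steinberg_symbol_dyadic]
      by (simp add: h_def real_symbol_def sign_symbol.commute[of dyadic_symbol "-1"]
          dyadic_symbol_two odd_sign8_def)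
  next
    case False
    have "(\<Prod>p\<in>S - {2}. tame_symbol p (-1) (int q)) = tame_symbol q (-1) (int q)"
      using nd1 nd[of _ q] q False by (intro split tame_symbol_units) auto
    thus ?thesis using False q odd[of q] nd1[OF q] S(2)[OF q] gt2[of q]
      by (simp add: h_def real_symbol_def dyadic_symbol_odd tame_symbol_unit_prime
          Legendre_minus_one odd_sign4_def)
  qed
  have two_q: "h 2 (int q) = 1" if q: "q \<in> S" "2 \<in> S" for q
  proof (cases "q = 2")
    case True
    have "(\<Prod>p\<in>S - {2}. tame_symbol p 2 2) = 1"
      using nd[of _ 2] q by (auto intro!: prod.neutral tame_symbol_units)
    thus ?thesis using True by (simp add: h_def real_symbol_def dyadic_symbol_two_two)
  next
    case False
    \<comment> \<open>The surviving factor is the Legendre symbol of 2 modulo q, equal to the dyadic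
      factor by the second supplement.\<close>
    have "(\<Prod>p\<in>S - {2}. tame_symbol p 2 (int q)) = tame_symbol q 2 (int q)"
      using nd[of _ q] nd[of _ 2] q False by (intro split tame_symbol_units) auto
    thus ?thesis using False q odd[of q] nd[OF q] S(2)[OF q(1)] gt2[of q]
      by (simp add: h_def real_symbol_def dyadic_symbol_two tame_symbol_unit_prime
          Legendre_two odd_sign8_def)
  qed
  have q_r: "h (int q) (int r) = 1" if q: "q \<in> S" and r: "r \<in> S" for q r
  proof -
    consider "q = 2" | "r = 2" | "q \<noteq> 2" "r \<noteq> 2" "q = r" | "q \<noteq> 2" "r \<noteq> 2" "q \<noteq> r" by blast
    thus ?thesis
    proof cases
      case 1
      thus ?thesis using two_q q r by simp
    next
      case 2
      thus ?thesis using two_q q r commute[of "int q" "int r"] by simp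
    next
      case 3
      \<comment> \<open>The factor at q is the Legendre symbol of -1, which matches the dyadic sign
        of (q, q).\<close>
      have "(\<Prod>p\<in>S - {2}. tame_symbol p (int q) (int q)) = tame_symbol q (int q) (int q)"
        using nd[of _ q] q 3 by (intro split tame_symbol_units) auto
      thus ?thesis using 3 q odd[of q] S(2)[OF q] gt2[of q]
        by (simp add: h_def real_symbol_def dyadic_symbol_odd tame_symbol_prime_prime
            Legendre_minus_one odd_sign4_def)
    next
      case 4
      \<comment> \<open>Only the factors at q and r survive; their product is the left side of
        quadratic reciprocity, and its right side is the dyadic sign.\<close>
      have "(\<Prod>p\<in>S - {2}. tame_symbol p (int q) (int r)) =
          tame_symbol q (int q) (int r) * (\<Prod>p\<in>S - {2} - {q}. tame_symbol p (int q) (int r))"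
        using q 4 S(1) by (intro prod.remove) auto
      also have "(\<Prod>p\<in>S - {2} - {q}. tame_symbol p (int q) (int r)) = tame_symbol r (int q) (int r)"
        using q r 4 S(1) nd by (subst prod.remove[of _ r]) (auto intro!: prod.neutral tame_symbol_units)
      also have "tame_symbol q (int q) (int r) = tame_symbol q (int r) (int q)"
        by (rule sign_symbol.commute[OF steinberg_symbol.axioms(1)[OF steinberg_symbol_tame]])
          (use S(2)[OF q] gt2 q 4 in auto)
      finally have "h (int q) (int r) = odd_sign4 (int q) (int r) *
          (Legendre (int r) (int q) * Legendre (int q) (int r))"
        using q r 4 nd S(2) odd[of q] odd[of r]
        by (simp add: h_def real_symbol_def dyadic_symbol_odd tame_symbol_unit_prime)
      also have "Legendre (int r) (int q) * Legendre (int q) (int r) =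
          (-1) ^ ((r - 1) div 2 * ((q - 1) div 2))"
        by (rule Quadratic_Reciprocity) (use S(2) q r 4 gt2 in auto)
      also have "\<dots> = odd_sign4 (int q) (int r)"
      proof -
        have "even ((x - 1) div 2) \<longleftrightarrow> int x mod 4 \<noteq> 3" if "odd x" for x :: nat
          using that by presburger
        thus ?thesis using odd q r 4 by (auto simp: odd_sign4_def minus_one_power_iff)
      qed
      finally show ?thesis by (simp add: odd_sign4_def)
    qed
  qed
  have "h a b = 1"
  proof (rule trivial_if_trivial_on_generators[OF S(2) _ ab div])
    fix q r assume "q \<in> insert (-1) (int ` S)" "r \<in> insert (-1) (int ` S)"
    thus "h q r = 1" using m1_m1 m1_q q_r commute by auto
  qed
  thus ?thesis by (simp add: h_def)
qed

subsection \<open>Isotropy of diagonal ternary forms over the \<open>p\<close>-adic numbers\<close>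

text \<open>Working with representing sequences rather than classes allows rescaling and
  approximation with rational numbers; null sequences play the role of zero.\<close>

definition padic_isotropic :: "nat \<Rightarrow> rat \<Rightarrow> rat \<Rightarrow> rat \<Rightarrow> bool" where
  "padic_isotropic p a b c \<longleftrightarrow>
     (\<exists>X Y Z. padic_Cauchy p X \<and> padic_Cauchy p Y \<and> padic_Cauchy p Z \<and>
        \<not> (X \<in> padic_null p \<and> Y \<in> padic_null p \<and> Z \<in> padic_null p) \<and>
        (\<lambda>n. a * X n ^ 2 + b * Y n ^ 2 + c * Z n ^ 2) \<in> padic_null p)"

lemma padic_isotropicI:
  "padic_Cauchy p X \<Longrightarrow> padic_Cauchy p Y \<Longrightarrow> padic_Cauchy p Z \<Longrightarrow>
   X \<notin> padic_null p \<or> Y \<notin> padic_null p \<or> Z \<notin> padic_null p \<Longrightarrow>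
   (\<lambda>n. a * X n ^ 2 + b * Y n ^ 2 + c * Z n ^ 2) \<in> padic_null p \<Longrightarrow> padic_isotropic p a b c"
  unfolding padic_isotropic_def by blast

lemma padic_isotropic_swap12: "padic_isotropic p a b c \<longleftrightarrow> padic_isotropic p b a c"
proof -
  have "padic_isotropic p b a c" if iso: "padic_isotropic p a b c" for a b c
  proof -
    obtain X Y Z where "padic_Cauchy p X" "padic_Cauchy p Y" "padic_Cauchy p Z"
      "X \<notin> padic_null p \<or> Y \<notin> padic_null p \<or> Z \<notin> padic_null p"
      "(\<lambda>n. a * X n ^ 2 + b * Y n ^ 2 + c * Z n ^ 2) \<in> padic_null p"
      using iso unfolding padic_isotropic_def by blast
    thus ?thesis by (intro padic_isotropicI[of p Y X Z]) (auto simp: algebra_simps)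
  qed
  thus ?thesis by blast
qed

lemma padic_isotropic_swap13: "padic_isotropic p a b c \<longleftrightarrow> padic_isotropic p c b a"
proof -
  have "padic_isotropic p c b a" if iso: "padic_isotropic p a b c" for a b c
  proof -
    obtain X Y Z where "padic_Cauchy p X" "padic_Cauchy p Y" "padic_Cauchy p Z"
      "X \<notin> padic_null p \<or> Y \<notin> padic_null p \<or> Z \<notin> padic_null p"
      "(\<lambda>n. a * X n ^ 2 + b * Y n ^ 2 + c * Z n ^ 2) \<in> padic_null p"
      using iso unfolding padic_isotropic_def by blast
    thus ?thesis by (intro padic_isotropicI[of p Z Y X]) (auto simp: algebra_simps)
  qed
  thus ?thesis by blast
qed

lemma padic_null_const_mult:
  assumes "prime p" "X \<in> padic_null p"
  shows "(\<lambda>n. t * X n) \<in> padic_null p"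
  using padic_null_mult[OF assms padic_Cauchy_const] .

lemma padic_null_const_mult_iff:
  assumes "prime p" "t \<noteq> 0"
  shows "(\<lambda>n. t * X n) \<in> padic_null p \<longleftrightarrow> X \<in> padic_null p"
  using padic_null_const_mult[OF assms(1), of X t]
    padic_null_const_mult[OF assms(1), of "\<lambda>n. t * X n" "1 / t"] assms(2) by auto

lemma padic_null_const_iff:
  assumes "prime p"
  shows "(\<lambda>n. q) \<in> padic_null p \<longleftrightarrow> q = 0"
  using padic_abs_pos[OF assms, of q] by (auto simp: padic_null_def)

lemma padic_isotropic_scale:
  assumes p: "prime p" and t: "t \<noteq> 0"
  shows "padic_isotropic p (t * a) (t * b) (t * c) \<longleftrightarrow> padic_isotropic p a b c"
proof -
  have "(\<lambda>n. t * a * X n ^ 2 + t * b * Y n ^ 2 + t * c * Z n ^ 2) =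
      (\<lambda>n. t * (a * X n ^ 2 + b * Y n ^ 2 + c * Z n ^ 2))" for X Y Z :: "nat \<Rightarrow> rat"
    by (simp add: algebra_simps)
  thus ?thesis unfolding padic_isotropic_def by (simp only: padic_null_const_mult_iff[OF p t])
qed

text \<open>The factor t^2 is absorbed by substituting t X for X; the converse is the same
  substitution with 1/t.\<close>

lemma padic_isotropic_square:
  assumes p: "prime p" and t: "t \<noteq> 0"
  shows "padic_isotropic p (t ^ 2 * a) b c \<longleftrightarrow> padic_isotropic p a b c"
proof -
  have imp: "padic_isotropic p a b c" if iso: "padic_isotropic p (t ^ 2 * a) b c" and t: "t \<noteq> 0" for a t
  proof -
    obtain X Y Z where X: "padic_Cauchy p X" "padic_Cauchy p Y" "padic_Cauchy p Z"
      "X \<notin> padic_null p \<or> Y \<notin> padic_null p \<or> Z \<notin> padic_null p"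
      "(\<lambda>n. t ^ 2 * a * X n ^ 2 + b * Y n ^ 2 + c * Z n ^ 2) \<in> padic_null p"
      using iso unfolding padic_isotropic_def by blast
    show ?thesis
      by (rule padic_isotropicI[of p "\<lambda>n. t * X n" Y Z])
        (use X padic_Cauchy_mult[OF p padic_Cauchy_const] padic_null_const_mult_iff[OF p t] in
          \<open>auto simp: power_mult_distrib mult_ac\<close>)
  qed
  show ?thesis
    using imp[of t a] imp[of "1 / t" "t ^ 2 * a"] t by (auto simp: power_divide)
qed

section \<open>From the Hilbert symbol to isotropy\<close>

text \<open>Multiplying z^2 = (-a/c) x^2 + (-b/c) y^2 by c gives the diagonal form. The rest passes
  between classes and representatives, on which the field operations act termwise.\<close>

lemma hilbert_symbol_eq_isotropic:
  assumes p: "prime p" and c: "c \<noteq> 0"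
  shows "hilbert_symbol p (padic_of_rat p (- a / c)) (padic_of_rat p (- b / c)) =
    (if padic_isotropic p a b c then 1 else -1)"
proof -
  let ?R = "padic_Cauchy_ring p" and ?I = "padic_null p" and ?K = "padic_field p"
  interpret R: cring ?R by (rule padic_Cauchy_ring_cring[OF p])
  interpret I: ideal ?I ?R by (rule padic_null_ideal[OF p])
  interpret K: field ?K by (rule padic_field_field[OF p])
  define cls where "cls X = ?I +>\<^bsub>?R\<^esub> X" for X
  have minus: "\<ominus>\<^bsub>?R\<^esub> X = (\<lambda>n. - X n)" if "padic_Cauchy p X" for X
    using that padic_Cauchy_uminus[OF p that] by (intro R.sum_zero_eq_neg[symmetric]) auto
  have cls_eq: "cls X = cls Y \<longleftrightarrow> (\<lambda>n. X n - Y n) \<in> ?I" if "padic_Cauchy p X" "padic_Cauchy p Y" for X Y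
    using R.quotient_eq_iff_same_a_r_cos[OF I.is_ideal, of X Y] that minus
    by (simp add: cls_def a_minus_def)
  have cls_mult: "cls X \<otimes>\<^bsub>?K\<^esub> cls Y = cls (\<lambda>n. X n * Y n)" if "padic_Cauchy p X" "padic_Cauchy p Y" for X Y
    using that I.rcoset_mult_add[of X Y] by (simp add: cls_def padic_field_def FactRing_def)
  have cls_add: "cls X \<oplus>\<^bsub>?K\<^esub> cls Y = cls (\<lambda>n. X n + Y n)" if "padic_Cauchy p X" "padic_Cauchy p Y" for X Y
    using that I.a_rcos_sum[of X Y] by (simp add: cls_def padic_field_def FactRing_def)
  have cls_carrier: "carrier ?K = cls ` {X. padic_Cauchy p X}"
    unfolding padic_field_carrier cls_def by auto
  have cls_pow: "cls X [^]\<^bsub>?K\<^esub> (2::nat) = cls (\<lambda>n. X n ^ 2)" if "padic_Cauchy p X" for X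
    using that cls_carrier by (simp add: numeral_2_eq_2 cls_mult)
  have cls_zero: "cls X = \<zero>\<^bsub>?K\<^esub> \<longleftrightarrow> X \<in> ?I" if "padic_Cauchy p X" for X
  proof -
    have "\<zero>\<^bsub>?K\<^esub> = cls (\<lambda>n. 0)"
      using padic_of_rat_eq_zero_iff[OF p, of 0] by (simp add: cls_def padic_of_rat_def)
    thus ?thesis using cls_eq[OF that padic_Cauchy_const, of 0] by simp
  qed
  have sq: "padic_Cauchy p (\<lambda>n. q * X n ^ 2)" if "padic_Cauchy p X" for X q
    unfolding power2_eq_square
    using padic_Cauchy_mult[OF p padic_Cauchy_const padic_Cauchy_mult[OF p that that]] .
  have sq1: "padic_Cauchy p (\<lambda>n. X n ^ 2)" if "padic_Cauchy p X" for X
    using sq[OF that, of 1] by simp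
  have eq: "cls Z [^]\<^bsub>?K\<^esub> (2::nat) = padic_of_rat p (- a / c) \<otimes>\<^bsub>?K\<^esub> cls X [^]\<^bsub>?K\<^esub> (2::nat) \<oplus>\<^bsub>?K\<^esub>
      padic_of_rat p (- b / c) \<otimes>\<^bsub>?K\<^esub> cls Y [^]\<^bsub>?K\<^esub> (2::nat) \<longleftrightarrow>
      (\<lambda>n. a * X n ^ 2 + b * Y n ^ 2 + c * Z n ^ 2) \<in> ?I"
    if C: "padic_Cauchy p X" "padic_Cauchy p Y" "padic_Cauchy p Z" for X Y Z
  proof -
    have "padic_of_rat p q = cls (\<lambda>n. q)" for q by (simp add: padic_of_rat_def cls_def)
    hence "cls Z [^]\<^bsub>?K\<^esub> (2::nat) = padic_of_rat p (- a / c) \<otimes>\<^bsub>?K\<^esub> cls X [^]\<^bsub>?K\<^esub> (2::nat) \<oplus>\<^bsub>?K\<^esub>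
      padic_of_rat p (- b / c) \<otimes>\<^bsub>?K\<^esub> cls Y [^]\<^bsub>?K\<^esub> (2::nat) \<longleftrightarrow>
      cls (\<lambda>n. Z n ^ 2) = cls (\<lambda>n. - a / c * X n ^ 2 + - b / c * Y n ^ 2)"
      by (simp only: cls_pow cls_mult cls_add padic_Cauchy_const C sq sq1)
    also have "\<dots> \<longleftrightarrow> (\<lambda>n. Z n ^ 2 - (- a / c * X n ^ 2 + - b / c * Y n ^ 2)) \<in> ?I"
      by (intro cls_eq sq1 padic_Cauchy_add[OF p] sq C)
    also have "\<dots> \<longleftrightarrow> (\<lambda>n. c * (Z n ^ 2 - (- a / c * X n ^ 2 + - b / c * Y n ^ 2))) \<in> ?I"
      using padic_null_const_mult_iff[OF p c] by simp
    also have "(\<lambda>n. c * (Z n ^ 2 - (- a / c * X n ^ 2 + - b / c * Y n ^ 2))) =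
        (\<lambda>n. a * X n ^ 2 + b * Y n ^ 2 + c * Z n ^ 2)"
      using c by (simp add: algebra_simps)
    finally show ?thesis .
  qed
  have "padic_isotropic p a b c \<longleftrightarrow> (\<exists>x\<in>carrier ?K. \<exists>y\<in>carrier ?K. \<exists>z\<in>carrier ?K.
           \<not> (x = \<zero>\<^bsub>?K\<^esub> \<and> y = \<zero>\<^bsub>?K\<^esub> \<and> z = \<zero>\<^bsub>?K\<^esub>) \<and>
           z [^]\<^bsub>?K\<^esub> (2::nat) = padic_of_rat p (- a / c) \<otimes>\<^bsub>?K\<^esub> x [^]\<^bsub>?K\<^esub> (2::nat) \<oplus>\<^bsub>?K\<^esub>
             padic_of_rat p (- b / c) \<otimes>\<^bsub>?K\<^esub> y [^]\<^bsub>?K\<^esub> (2::nat))" (is "_ \<longleftrightarrow> ?solvable")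
  proof
    assume "padic_isotropic p a b c"
    then obtain X Y Z where C: "padic_Cauchy p X" "padic_Cauchy p Y" "padic_Cauchy p Z"
      and XYZ: "\<not> (X \<in> ?I \<and> Y \<in> ?I \<and> Z \<in> ?I)"
        "(\<lambda>n. a * X n ^ 2 + b * Y n ^ 2 + c * Z n ^ 2) \<in> ?I"
      unfolding padic_isotropic_def by blast
    show ?solvable
    proof (intro bexI conjI)
      show "\<not> (cls X = \<zero>\<^bsub>?K\<^esub> \<and> cls Y = \<zero>\<^bsub>?K\<^esub> \<and> cls Z = \<zero>\<^bsub>?K\<^esub>)"
        using XYZ(1) by (simp add: cls_zero C)
    qed (use C XYZ(2) in \<open>simp_all only: eq cls_carrier mem_Collect_eq imageI\<close>)
  next
    assume ?solvable
    then obtain x y z where xyz: "x \<in> carrier ?K" "y \<in> carrier ?K" "z \<in> carrier ?K"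
        "\<not> (x = \<zero>\<^bsub>?K\<^esub> \<and> y = \<zero>\<^bsub>?K\<^esub> \<and> z = \<zero>\<^bsub>?K\<^esub>)"
        "z [^]\<^bsub>?K\<^esub> (2::nat) = padic_of_rat p (- a / c) \<otimes>\<^bsub>?K\<^esub> x [^]\<^bsub>?K\<^esub> (2::nat) \<oplus>\<^bsub>?K\<^esub>
             padic_of_rat p (- b / c) \<otimes>\<^bsub>?K\<^esub> y [^]\<^bsub>?K\<^esub> (2::nat)" by blast
    from xyz(1-3) obtain X Y Z where C: "padic_Cauchy p X" "padic_Cauchy p Y" "padic_Cauchy p Z"
      and eqs: "x = cls X" "y = cls Y" "z = cls Z" unfolding cls_carrier by blast
    show "padic_isotropic p a b c"
      using xyz(4) eq[OF C] xyz(5) unfolding eqs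
      by (intro padic_isotropicI[OF C]) (simp_all add: cls_zero C)
  qed
  thus ?thesis by (simp add: hilbert_symbol_def Let_def)
qed

section \<open>Approximation, integrality and square roots\<close>

text \<open>Terms of size at least e occur arbitrarily far out. If a late term were smaller than e,
  the ultrametric inequality would make a nearby large term smaller than e too.\<close>

lemma padic_Cauchy_bounded_below:
  assumes p: "prime p" and X: "padic_Cauchy p X" and nn: "X \<notin> padic_null p"
  obtains e N where "e > 0" "\<And>n. n \<ge> N \<Longrightarrow> e \<le> padic_abs p (X n)"
proof -
  obtain e where e: "e > 0" "\<forall>N. \<exists>n\<ge>N. padic_abs p (X n) \<ge> e"
    using nn unfolding padic_null_def by (auto simp: not_less)
  obtain M where M: "\<forall>m\<ge>M. \<forall>n\<ge>M. padic_abs p (X m - X n) < e"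
    using X e unfolding padic_Cauchy_def by blast
  have "e \<le> padic_abs p (X n)" if n: "n \<ge> M" for n
  proof (rule ccontr)
    assume a: "\<not> e \<le> padic_abs p (X n)"
    obtain m where m: "m \<ge> M" "padic_abs p (X m) \<ge> e" using e by blast
    have "padic_abs p (X m - X n + X n) < e"
      using M m n a by (intro padic_abs_add_less[OF p]) auto
    thus False using m by simp
  qed
  thus ?thesis using that e(1) by blast
qed

lemma padic_abs_of_int_le_iff:
  assumes p: "prime p"
  shows "padic_abs p (of_int m) \<le> 1 / real p ^ k \<longleftrightarrow> int p ^ k dvd m"
proof (cases "m = 0")
  case False
  have p1: "real p > 1" using prime_gt_1_nat[OF p] by simp
  have "padic_abs p (of_int m) = real p powi (- int (multiplicity (int p) m))"
    using padic_abs_quotient[OF p False, of 1] by simp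
  also have "\<dots> = 1 / real p ^ multiplicity (int p) m"
    by (simp add: power_int_minus divide_inverse)
  finally have "padic_abs p (of_int m) \<le> 1 / real p ^ k \<longleftrightarrow>
      1 / real p ^ multiplicity (int p) m \<le> 1 / real p ^ k" by simp
  also have "\<dots> \<longleftrightarrow> real p ^ k \<le> real p ^ multiplicity (int p) m"
    using p1 by (simp add: field_simps)
  also have "\<dots> \<longleftrightarrow> k \<le> multiplicity (int p) m" using p1 by simp
  also have "\<dots> \<longleftrightarrow> int p ^ k dvd m"
    by (rule power_dvd_iff_le_multiplicity[symmetric]) (use False p in auto)
  finally show ?thesis .
qed auto

text \<open>Nonzero values are powers of p, so a strict bound gains one more factor p.\<close>

lemma padic_abs_of_int_less:
  assumes p: "prime p" and m: "padic_abs p (of_int m) < 1 / real p ^ k"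
  shows "int p ^ Suc k dvd m"
proof (cases "m = 0")
  case False
  have p1: "real p > 1" using prime_gt_1_nat[OF p] by simp
  have "padic_abs p (of_int m) = real p powi (- int (multiplicity (int p) m))"
    using padic_abs_quotient[OF p False, of 1] by simp
  also have "\<dots> = 1 / real p ^ multiplicity (int p) m"
    by (simp add: power_int_minus divide_inverse)
  finally have "1 / real p ^ multiplicity (int p) m < 1 / real p ^ k" using m by simp
  hence "real p ^ k < real p ^ multiplicity (int p) m"
    using p1 by (simp add: field_simps)
  hence "Suc k \<le> multiplicity (int p) m" using p1 by simp
  thus ?thesis by (rule multiplicity_dvd')
qed auto

text \<open>Denominators are cleared and the gcd of the three numerators is divided out.\<close>

lemma primitive_multiple:
  fixes x y z :: rat
  assumes p: "prime p" and nz: "x \<noteq> 0 \<or> y \<noteq> 0 \<or> z \<noteq> 0"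
  obtains t a b c where "t \<noteq> 0" "t * x = of_int a" "t * y = of_int b" "t * z = of_int c"
    "\<not> (int p dvd a \<and> int p dvd b \<and> int p dvd c)"
proof -
  obtain x1 x2 where x: "x = of_int x1 / of_int x2" "x2 \<noteq> 0" by (rule rat_eq_quotient)
  obtain y1 y2 where y: "y = of_int y1 / of_int y2" "y2 \<noteq> 0" by (rule rat_eq_quotient)
  obtain z1 z2 where z: "z = of_int z1 / of_int z2" "z2 \<noteq> 0" by (rule rat_eq_quotient)
  define a b c where "a = x1 * y2 * z2" and "b = y1 * x2 * z2" and "c = z1 * x2 * y2"
  define g where "g = gcd a (gcd b c)"
  have "a \<noteq> 0 \<or> b \<noteq> 0 \<or> c \<noteq> 0" using nz x y z by (auto simp: a_def b_def c_def)
  hence g: "g \<noteq> 0" by (auto simp: g_def)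
  have gd: "g dvd a" "g dvd b" "g dvd c" by (auto simp: g_def intro: dvd_trans)
  have div: "of_int (m div g) = (of_int m / of_int g :: rat)" if "g dvd m" for m
    using that g by auto
  define t :: rat where "t = of_int (x2 * y2 * z2) / of_int g"
  show ?thesis
  proof (rule that[of t "a div g" "b div g" "c div g"])
    show "t \<noteq> 0" using x y z g by (simp add: t_def)
    have "t * x = of_int a / of_int g" "t * y = of_int b / of_int g" "t * z = of_int c / of_int g"
      using x y z by (simp_all add: t_def a_def b_def c_def)
    thus "t * x = of_int (a div g)" "t * y = of_int (b div g)" "t * z = of_int (c div g)"
      by (simp_all only: gd[THEN div])
    show "\<not> (int p dvd a div g \<and> int p dvd b div g \<and> int p dvd c div g)"
    proof
      assume "int p dvd a div g \<and> int p dvd b div g \<and> int p dvd c div g"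
      hence "int p * g dvd a" "int p * g dvd b" "int p * g dvd c"
        using gd g by (auto simp: dvd_div_iff_mult)
      hence "int p * g dvd 1 * g" unfolding mult_1 by (simp add: g_def)
      hence "int p dvd 1" using g by (subst (asm) dvd_mult_cancel_right) auto
      thus False using p by auto
    qed
  qed
qed

text \<open>Hensel lifting: a root modulo p is improved by Newton steps, and the resulting integers
  form a Cauchy sequence.\<close>

lemma padic_sqrt_exists:
  assumes p: "prime p" "2 < p" and c: "\<not> int p dvd c" "QuadRes (int p) c"
  obtains S where "padic_Cauchy p S" "(\<lambda>n. S n ^ 2 - of_int c) \<in> padic_null p"
proof -
  have P: "prime (int p)" using p by simp
  have "\<exists>s. \<forall>n. int p ^ Suc n dvd s n ^ 2 - c \<and> int p ^ Suc n dvd s (Suc n) - s n"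
  proof (rule dependent_nat_choice)
    show "\<exists>x. int p ^ Suc 0 dvd x ^ 2 - c"
      using c by (auto simp: QuadRes_def cong_iff_dvd_diff)
  next
    fix x n assume x: "int p ^ Suc n dvd x ^ 2 - c"
    then obtain m where m: "x ^ 2 - c = int p ^ Suc n * m" by (auto elim: dvdE)
    have "int p dvd x ^ 2 - c" using x by (simp add: dvd_mult_left)
    hence "\<not> int p dvd x"
      using c(1) by (metis dvd_diff_commute dvd_diffD dvd_power pos2 dvd_trans zdvd_zdiffD dvd_diff_left_iff)
    hence "\<not> int p dvd 2 * x"
      using P p zdvd_not_zless[of 2 "int p"] by (simp add: prime_dvd_mult_iff)
    hence "coprime (2 * x) (int p)" using P prime_imp_coprime coprime_commute by blast
    then obtain t where "[2 * x * t = 1] (mod int p)" using cong_solve_coprime_int by blast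
    hence "int p dvd (2 * x * t - 1) * m" by (simp add: cong_iff_dvd_diff)
    \<comment> \<open>Newton step: the error of \<open>x\<close> is p^(n+1) m, and \<open>t\<close>
      inverts the derivative 2x modulo p, so the linear term cancels the error modulo
      p^(n+2).\<close>
    define y where "y = x - int p ^ Suc n * (t * m)"
    have "y ^ 2 - c = (x ^ 2 - c) - int p ^ Suc n * (2 * x * t * m) + (int p ^ Suc n) ^ 2 * (t * m) ^ 2"
      by (simp add: y_def power2_eq_square algebra_simps)
    also have "\<dots> = - (int p ^ Suc n * ((2 * x * t - 1) * m)) + (int p ^ Suc n) ^ 2 * (t * m) ^ 2"
      by (simp add: m algebra_simps)
    finally have y: "y ^ 2 - c = - (int p ^ Suc n * ((2 * x * t - 1) * m)) + (int p ^ Suc n) ^ 2 * (t * m) ^ 2" .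
    have "int p ^ Suc (Suc n) dvd int p ^ Suc n * ((2 * x * t - 1) * m)"
      using \<open>int p dvd (2 * x * t - 1) * m\<close> by (simp only: power_Suc2 mult_dvd_mono dvd_refl)
    \<comment> \<open>The quadratic term has exponent 2n + 2, which is at least n + 2 even for n =
      0.\<close>
    moreover have "int p ^ Suc (Suc n) dvd (int p ^ Suc n) ^ 2 * (t * m) ^ 2"
      unfolding power_mult[symmetric] by (intro dvd_mult2 le_imp_power_dvd) simp
    ultimately have "int p ^ Suc (Suc n) dvd y ^ 2 - c" unfolding y by simp
    moreover have "int p ^ Suc n dvd y - x" by (simp add: y_def)
    ultimately show "\<exists>y. int p ^ Suc (Suc n) dvd y ^ 2 - c \<and> int p ^ Suc n dvd y - x" by blast
  qed
  then obtain s where s: "\<And>n. int p ^ Suc n dvd s n ^ 2 - c" "\<And>n. int p ^ Suc n dvd s (Suc n) - s n"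
    by blast
  have p1: "real p > 1" using p by simp
  have small: "\<exists>N. \<forall>n\<ge>N. 1 / real p ^ n < e" if e: "e > 0" for e
  proof -
    have "1 / real p < 1" using p1 by simp
    then obtain N where N: "(1 / real p) ^ N < e" using real_arch_pow_inv[OF e] by blast
    have "1 / real p ^ n < e" if "n \<ge> N" for n
    proof -
      have "(1 / real p) ^ n \<le> (1 / real p) ^ N" using that p1 by (intro power_decreasing) auto
      thus ?thesis using N by (simp add: power_one_over)
    qed
    thus ?thesis by blast
  qed
  have diff: "int p ^ n dvd s m - s n" if "m \<ge> n" for m n
    using that
  proof (induction m rule: dec_induct)
    case (step m)
    have "int p ^ n dvd s (Suc m) - s m"
      using s(2)[of m] step.hyps by (meson dvd_trans le_imp_power_dvd le_SucI)
    hence "int p ^ n dvd (s (Suc m) - s m) + (s m - s n)" using step.IH by (rule dvd_add)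
    thus ?case by simp
  qed simp
  show ?thesis
  proof (rule that[of "\<lambda>n. of_int (s n)"])
    show "padic_Cauchy p (\<lambda>n. of_int (s n))"
      unfolding padic_Cauchy_def
    proof (intro allI impI)
      fix e :: real assume "e > 0"
      then obtain N where N: "\<forall>n\<ge>N. 1 / real p ^ n < e" using small by blast
      have "padic_abs p (of_int (s m) - of_int (s n)) < e" if "m \<ge> N" "n \<ge> N" for m n
      proof -
        \<comment> \<open>Comparing both terms with \<open>s N\<close> avoids a case distinction on
          the order of m and n.\<close>
        have "int p ^ N dvd (s m - s N) - (s n - s N)" by (intro dvd_diff diff that)
        hence "padic_abs p (of_int (s m - s n)) \<le> 1 / real p ^ N"
          by (subst padic_abs_of_int_le_iff[OF p(1)]) simp
        thus ?thesis using N by (auto intro: le_less_trans)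
      qed
      thus "\<exists>N. \<forall>m\<ge>N. \<forall>n\<ge>N. padic_abs p (of_int (s m) - of_int (s n)) < e" by blast
    qed
    show "(\<lambda>n. of_int (s n) ^ 2 - of_int c) \<in> padic_null p"
      unfolding padic_null_def
    proof (intro CollectI allI impI)
      fix e :: real assume "e > 0"
      then obtain N where N: "\<forall>n\<ge>N. 1 / real p ^ n < e" using small by blast
      have "padic_abs p (of_int (s n) ^ 2 - of_int c) < e" if "n \<ge> N" for n
      proof -
        have "int p ^ n dvd s n ^ 2 - c" using s(1)[of n] by (simp add: dvd_mult_right)
        hence "padic_abs p (of_int (s n ^ 2 - c)) \<le> 1 / real p ^ n"
          by (subst padic_abs_of_int_le_iff[OF p(1)])
        moreover have "1 / real p ^ n < e" using N that by blast
        ultimately show ?thesis by simp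
      qed
      thus "\<exists>N. \<forall>n\<ge>N. padic_abs p (of_int (s n) ^ 2 - of_int c) < e" by blast
    qed
  qed
qed

section \<open>Isotropy criteria at odd primes\<close>

text \<open>The vector (w3 x, w3 y, sqrt c) is a zero of the form: the first two terms add up to -w3
  c and the third is w3 c.\<close>

lemma padic_isotropic_of_QuadRes:
  fixes w1 w2 w3 x y :: int
  assumes p: "prime p" "2 < p"
    and c: "c = - (w3 * (w1 * x ^ 2 + w2 * y ^ 2))" "\<not> int p dvd c" "QuadRes (int p) c"
  shows "padic_isotropic p (of_int w1) (of_int w2) (of_int w3)"
proof -
  obtain S where S: "padic_Cauchy p S" "(\<lambda>n. S n ^ 2 - of_int c) \<in> padic_null p"
    using padic_sqrt_exists[OF p c(2,3)] .
  have nz: "w3 \<noteq> 0" "x \<noteq> 0 \<or> y \<noteq> 0" using c(1,2) by auto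
  have eq: "of_int w1 * (of_int (w3 * x))\<^sup>2 + of_int w2 * (of_int (w3 * y))\<^sup>2 + of_int w3 * (S n)\<^sup>2 =
      of_int w3 * (S n ^ 2 - of_int c)" for n
    unfolding c(1) by (simp add: power2_eq_square algebra_simps)
  show ?thesis
  proof (rule padic_isotropicI[of p "\<lambda>n. of_int (w3 * x)" "\<lambda>n. of_int (w3 * y)" S])
    show "(\<lambda>n. of_int w1 * (of_int (w3 * x))\<^sup>2 + of_int w2 * (of_int (w3 * y))\<^sup>2 + of_int w3 * (S n)\<^sup>2)
      \<in> padic_null p"
      unfolding eq by (rule padic_null_const_mult[OF p(1) S(2)])
  qed (use S nz p in \<open>auto simp: padic_Cauchy_const padic_null_const_iff\<close>)
qed

text \<open>It suffices that u x^2 + v y^2 is a nonzero square modulo p for some integers x, y. If u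
  or v is a residue, a coordinate vector works; otherwise a representation is built from two
  consecutive integers, a residue and a non-residue.\<close>

lemma padic_isotropic_units:
  fixes w1 w2 w3 :: int
  assumes p: "prime p" "2 < p" and w: "\<not> int p dvd w1" "\<not> int p dvd w2" "\<not> int p dvd w3"
  shows "padic_isotropic p (of_int w1) (of_int w2) (of_int w3)"
proof -
  define u v where "u = - (w1 * w3)" and "v = - (w2 * w3)"
  have P: "prime (int p)" using p by simp
  have uv: "\<not> int p dvd u" "\<not> int p dvd v"
    using w P by (auto simp: u_def v_def prime_dvd_mult_iff)
  show ?thesis
  proof (cases "QuadRes (int p) u \<or> QuadRes (int p) v")
    case True
    thus ?thesis
      using padic_isotropic_of_QuadRes[OF p, of u w3 w1 1 w2 0]
        padic_isotropic_of_QuadRes[OF p, of v w3 w1 0 w2 1] uv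
      by (auto simp: u_def v_def mult_ac)
  next
    case False
    hence nonres: "\<not> QuadRes (int p) u" "\<not> QuadRes (int p) v" by auto
    have res0: "QuadRes (int p) x" if "int p dvd x" for x
      using that by (auto simp: QuadRes_def cong_iff_dvd_diff intro!: exI[of _ 0])
    \<comment> \<open>The least positive non-residue exceeds a square by one.\<close>
    define r where "r = (LEAST k::nat. \<not> QuadRes (int p) (int k))"
    have ex: "\<exists>k::nat. \<not> QuadRes (int p) (int k)"
    proof -
      have "[int (nat (u mod int p)) = u] (mod int p)" using p by (simp add: cong_def)
      hence "\<not> QuadRes (int p) (int (nat (u mod int p)))"
        using nonres(1) unfolding QuadRes_def by (meson cong_trans)
      thus ?thesis by blast
    qed
    hence r: "\<not> QuadRes (int p) (int r)" unfolding r_def by (rule LeastI_ex)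
    have "r \<noteq> 0" using r res0 by (metis dvd_0_right of_nat_0)
    hence "QuadRes (int p) (int (r - 1))"
      using not_less_Least[of "r - 1" "\<lambda>k. \<not> QuadRes (int p) (int k)"] by (auto simp: r_def)
    then obtain s where "[s ^ 2 = int (r - 1)] (mod int p)" by (auto simp: QuadRes_def)
    hence "[s ^ 2 + 1 = int (r - 1) + 1] (mod int p)" by (rule cong_add) simp
    hence s: "[s ^ 2 + 1 = int r] (mod int p)" using \<open>r \<noteq> 0\<close> by (simp add: of_nat_diff)
    have nr: "\<not> int p dvd int r" using r res0 by blast
    \<comment> \<open>The product of two non-residues is a residue.\<close>
    have res_times_r: "\<exists>g. [g ^ 2 = x * int r] (mod int p)" if "\<not> int p dvd x" "\<not> QuadRes (int p) x" for x
    proof -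
      have "Legendre (x * int r) (int p) = 1"
        using that nr r Legendre_eq_1_iff[OF that(1)] Legendre_eq_1_iff[OF nr]
          Legendre_sign[OF that(1)] Legendre_sign[OF nr]
        by (auto simp: Legendre_mult[OF p])
      hence "QuadRes (int p) (x * int r)"
        using that(1) nr P by (subst (asm) Legendre_eq_1_iff) (auto simp: prime_dvd_mult_iff)
      thus ?thesis by (simp add: QuadRes_def)
    qed
    obtain g where g: "[g ^ 2 = u * int r] (mod int p)" using res_times_r uv nonres by blast
    obtain h where h: "[h ^ 2 = v * int r] (mod int p)" using res_times_r uv nonres by blast
    \<comment> \<open>Since u r = g^2, v r = h^2 and s^2 + 1 = r modulo p, c r = (g h)^2 (s^2 + 1) =
      (g h)^2 r, so c is the square of g h modulo p.\<close>
    define c where "c = u * (s * h) ^ 2 + v * g ^ 2"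
    have ng: "\<not> int p dvd g" "\<not> int p dvd h"
      using g h uv nr P cong_dvd_iff[OF g] cong_dvd_iff[OF h]
      by (auto simp: prime_dvd_mult_iff prime_dvd_power_iff)
    have "c * int r = (u * int r) * (s * h) ^ 2 + (v * int r) * g ^ 2"
      by (simp add: c_def algebra_simps)
    also have "[\<dots> = g ^ 2 * (s * h) ^ 2 + h ^ 2 * g ^ 2] (mod int p)"
      by (intro cong_add cong_mult cong_refl cong_sym[OF g] cong_sym[OF h])
    also have "g ^ 2 * (s * h) ^ 2 + h ^ 2 * g ^ 2 = (g * h) ^ 2 * (s ^ 2 + 1)"
      by (simp add: power_mult_distrib algebra_simps)
    also have "[\<dots> = (g * h) ^ 2 * int r] (mod int p)"
      by (intro cong_mult cong_refl s)
    finally have "[c * int r = (g * h) ^ 2 * int r] (mod int p)" .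
    moreover have "coprime (int r) (int p)"
      using nr P prime_imp_coprime coprime_commute by blast
    ultimately have c: "[c = (g * h) ^ 2] (mod int p)" by (simp add: cong_mult_rcancel)
    show ?thesis
    proof (rule padic_isotropic_of_QuadRes[OF p])
      show "c = - (w3 * (w1 * (s * h) ^ 2 + w2 * g ^ 2))"
        by (simp add: c_def u_def v_def algebra_simps)
      show "\<not> int p dvd c"
        using cong_dvd_iff[OF c] ng P by (auto simp: prime_dvd_mult_iff prime_dvd_power_iff)
      show "QuadRes (int p) c" using c cong_sym unfolding QuadRes_def by blast
    qed
  qed
qed

text \<open>Rescaled to a primitive integer vector (a, b, c), the zero is exact modulo p^2. Modulo p
  this reads w2 b^2 = -w3 c^2, and primitivity makes c invertible, so -w2 w3 is the square of w2 b /
  c.\<close>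

lemma QuadRes_of_approximate_zero:
  fixes w1 w2 w3 :: int and x y z :: rat
  assumes p: "prime p" and w: "\<not> int p dvd w1" "\<not> int p dvd w2" "\<not> int p dvd w3"
    and e: "e > 0" "e \<le> padic_abs p x \<or> e \<le> padic_abs p y \<or> e \<le> padic_abs p z"
    and small: "padic_abs p (of_int (int p * w1) * x ^ 2 + of_int w2 * y ^ 2 + of_int w3 * z ^ 2) < e ^ 2 / real p"
  shows "QuadRes (int p) (- (w2 * w3))"
proof -
  have P: "prime (int p)" using p by simp
  have "x \<noteq> 0 \<or> y \<noteq> 0 \<or> z \<noteq> 0" using e by auto
  then obtain t a b c where t: "t \<noteq> 0" "t * x = of_int a" "t * y = of_int b" "t * z = of_int c"
    "\<not> (int p dvd a \<and> int p dvd b \<and> int p dvd c)"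
    using primitive_multiple[OF p] by metis
  have int_le: "padic_abs p (of_int m) \<le> 1" for m
    using padic_abs_of_int_le_iff[OF p, of m 0] by simp
  \<comment> \<open>Some coordinate has size at least e, and t times it is an integer.\<close>
  have "padic_abs p t * e \<le> 1"
  proof -
    have "padic_abs p t * padic_abs p x \<le> 1" "padic_abs p t * padic_abs p y \<le> 1"
      "padic_abs p t * padic_abs p z \<le> 1"
      using int_le t by (simp_all flip: padic_abs_mult[OF p])
    thus ?thesis using e(2) padic_abs_nonneg[of p t] mult_left_mono order_trans by metis
  qed
  moreover have "0 \<le> padic_abs p t * e" using e padic_abs_nonneg[of p t] by simp
  ultimately have te: "(padic_abs p t * e) ^ 2 \<le> 1" by (rule power_le_one[rotated])
  define F where "F = int p * w1 * a ^ 2 + w2 * b ^ 2 + w3 * c ^ 2"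
  have "of_int F = t ^ 2 * (of_int (int p * w1) * x ^ 2 + of_int w2 * y ^ 2 + of_int w3 * z ^ 2)"
    by (simp add: F_def t(2-4)[symmetric] power_mult_distrib algebra_simps)
  hence "padic_abs p (of_int F) = padic_abs p t ^ 2 *
      padic_abs p (of_int (int p * w1) * x ^ 2 + of_int w2 * y ^ 2 + of_int w3 * z ^ 2)"
    by (simp add: padic_abs_mult[OF p] power2_eq_square)
  also have "\<dots> < padic_abs p t ^ 2 * (e ^ 2 / real p)"
    using small padic_abs_pos[OF p t(1)] by (intro mult_strict_left_mono) auto
  also have "\<dots> = (padic_abs p t * e) ^ 2 / real p" by (simp add: power_mult_distrib)
  also have "\<dots> \<le> 1 / real p" using te by (intro divide_right_mono) auto
  finally have "padic_abs p (of_int F) < 1 / real p ^ 1" by simp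
  \<comment> \<open>The bound e^2 / p was chosen to make the size of F strictly below 1/p, which
    yields the second factor p.\<close>
  from padic_abs_of_int_less[OF p this] have F: "int p ^ 2 dvd F" by (simp add: numeral_2_eq_2)
  hence "int p dvd F" by (rule dvd_trans[rotated]) simp
  hence d: "int p dvd w2 * b ^ 2 + w3 * c ^ 2"
    unfolding F_def by (simp add: dvd_add_right_iff add.assoc mult.assoc)
  have bc: "int p dvd b \<longleftrightarrow> int p dvd c"
  proof -
    have "int p dvd w2 * b ^ 2 \<longleftrightarrow> int p dvd w3 * c ^ 2"
      using d dvd_add_right_iff dvd_add_left_iff by blast
    thus ?thesis using w P by (simp add: prime_dvd_mult_iff prime_dvd_power_iff)
  qed
  \<comment> \<open>If p divided c, it would divide b as well; then p^2 divides p w1 a^2, so p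
    divides a, against primitivity.\<close>
  have nc: "\<not> int p dvd c"
  proof
    assume c: "int p dvd c"
    hence "int p ^ 2 dvd b ^ 2" "int p ^ 2 dvd c ^ 2" using bc by (simp_all add: dvd_power_same)
    hence "int p ^ 2 dvd w2 * b ^ 2 + w3 * c ^ 2" by simp
    hence "int p ^ 2 dvd int p * w1 * a ^ 2"
      using F unfolding F_def by (metis add.assoc dvd_add_left_iff)
    hence "int p * int p dvd int p * (w1 * a ^ 2)" by (simp add: power2_eq_square mult.assoc)
    hence "int p dvd w1 * a ^ 2" using p by (subst (asm) dvd_mult_cancel_left) auto
    hence "int p dvd a" using w P by (simp add: prime_dvd_mult_iff prime_dvd_power_iff)
    thus False using t(5) bc c by blast
  qed
  hence "coprime c (int p)" using P prime_imp_coprime coprime_commute by blast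
  then obtain i where i: "[c * i = 1] (mod int p)" using cong_solve_coprime_int by blast
  have "[w2 * b ^ 2 = - (w3 * c ^ 2)] (mod int p)" using d by (simp add: cong_iff_dvd_diff)
  hence "[w2 * i ^ 2 * (w2 * b ^ 2) = w2 * i ^ 2 * (- (w3 * c ^ 2))] (mod int p)"
    by (intro cong_mult cong_refl)
  also have "w2 * i ^ 2 * (- (w3 * c ^ 2)) = - (w2 * w3) * (c * i) ^ 2"
    by (simp add: power_mult_distrib algebra_simps)
  also have "[\<dots> = - (w2 * w3) * 1 ^ 2] (mod int p)"
    by (intro cong_mult cong_refl cong_pow i)
  also have "w2 * i ^ 2 * (w2 * b ^ 2) = (w2 * b * i) ^ 2"
    by (simp add: power2_eq_square algebra_simps)
  finally show ?thesis unfolding QuadRes_def by auto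
qed

text \<open>One sufficiently late term of the representing sequences is already a good enough
  approximate zero.\<close>

lemma QuadRes_of_padic_isotropic:
  fixes w1 w2 w3 :: int
  assumes p: "prime p" and w: "\<not> int p dvd w1" "\<not> int p dvd w2" "\<not> int p dvd w3"
    and iso: "padic_isotropic p (of_int (int p * w1)) (of_int w2) (of_int w3)"
  shows "QuadRes (int p) (- (w2 * w3))"
proof -
  obtain X Y Z where C: "padic_Cauchy p X" "padic_Cauchy p Y" "padic_Cauchy p Z"
    and nn: "X \<notin> padic_null p \<or> Y \<notin> padic_null p \<or> Z \<notin> padic_null p"
    and F: "(\<lambda>n. of_int (int p * w1) * X n ^ 2 + of_int w2 * Y n ^ 2 + of_int w3 * Z n ^ 2) \<in> padic_null p"
    using iso unfolding padic_isotropic_def by blast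
  have "\<exists>e N. e > 0 \<and>
      (\<forall>n\<ge>N. e \<le> padic_abs p (X n) \<or> e \<le> padic_abs p (Y n) \<or> e \<le> padic_abs p (Z n))"
    using nn C padic_Cauchy_bounded_below[OF p] by metis
  then obtain e N where e: "e > 0"
    "\<And>n. n \<ge> N \<Longrightarrow> e \<le> padic_abs p (X n) \<or> e \<le> padic_abs p (Y n) \<or> e \<le> padic_abs p (Z n)"
    by blast
  have "e ^ 2 / real p > 0" using e prime_gt_0_nat[OF p] by simp
  then obtain M where M: "\<forall>n\<ge>M. padic_abs p (of_int (int p * w1) * X n ^ 2 + of_int w2 * Y n ^ 2
      + of_int w3 * Z n ^ 2) < e ^ 2 / real p"
    using padic_nullD[OF F] by blast
  show ?thesis
    using QuadRes_of_approximate_zero[OF p w e(1) e(2)[of "max M N"]] M by simp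
qed

lemma padic_isotropic_prime_power:
  assumes p: "prime p" and "even k"
  shows "padic_isotropic p (of_int (int p ^ k * w)) b c \<longleftrightarrow> padic_isotropic p (of_int w) b c"
proof -
  obtain j where "k = 2 * j" using \<open>even k\<close> by blast
  hence "(of_int (int p ^ k * w) :: rat) = (of_nat p ^ j) ^ 2 * of_int w"
    by (simp add: power_mult[symmetric] mult.commute)
  thus ?thesis using padic_isotropic_square[OF p, of "of_nat p ^ j"] p by auto
qed

text \<open>Scaling by p^v3 makes the exponents of the last two coefficients even; removing squares
  leaves p^(v1+v3) w1, w2, w3. For even v1 + v3 this is a unit form, hence isotropic; for odd v1 +
  v3 isotropy means that -w2 w3 is a residue.\<close>

lemma padic_isotropic_iff_Legendre:
  fixes u1 u2 u3 :: int
  assumes p: "prime p" "2 < p" and u: "u1 \<noteq> 0" "u2 \<noteq> 0" "u3 \<noteq> 0"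
    and even: "even (multiplicity (int p) u2 + multiplicity (int p) u3)"
  shows "padic_isotropic p (of_int u1) (of_int u2) (of_int u3) \<longleftrightarrow>
    Legendre (- (unit_part p u2 * unit_part p u3)) p ^
      (multiplicity (int p) u1 + multiplicity (int p) u3) = 1"
proof -
  have P: "prime (int p)" using p by simp
  define v1 v2 v3 where v: "v1 = multiplicity (int p) u1" "v2 = multiplicity (int p) u2"
    "v3 = multiplicity (int p) u3"
  define w1 w2 w3 where w: "w1 = unit_part p u1" "w2 = unit_part p u2" "w3 = unit_part p u3"
  have uw: "u1 = int p ^ v1 * w1" "u2 = int p ^ v2 * w2" "u3 = int p ^ v3 * w3"
    unfolding v w by (rule unit_part_decompose)+
  have nd: "\<not> int p dvd w1" "\<not> int p dvd w2" "\<not> int p dvd w3"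
    unfolding w using u P by (simp_all add: unit_part_not_dvd)
  have ndw: "\<not> int p dvd - (w2 * w3)" using nd P by (simp add: prime_dvd_mult_iff)
  have "padic_isotropic p (of_int u1) (of_int u2) (of_int u3) \<longleftrightarrow>
      padic_isotropic p (of_int (int p ^ (v1 + v3) * w1)) (of_int (int p ^ (v2 + v3) * w2))
        (of_int (int p ^ (v3 + v3) * w3))"
    using padic_isotropic_scale[OF p(1), of "of_nat p ^ v3" "of_int u1" "of_int u2" "of_int u3"] p
    by (simp add: uw power_add mult_ac)
  \<comment> \<open>The swaps bring each coefficient into the first slot, where even powers of p can
    be removed, and then restore the order.\<close>
  also have "\<dots> \<longleftrightarrow> padic_isotropic p (of_int (int p ^ (v2 + v3) * w2))
      (of_int (int p ^ (v1 + v3) * w1)) (of_int (int p ^ (v3 + v3) * w3))"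
    by (rule padic_isotropic_swap12)
  also have "\<dots> \<longleftrightarrow> padic_isotropic p (of_int w2)
      (of_int (int p ^ (v1 + v3) * w1)) (of_int (int p ^ (v3 + v3) * w3))"
    using even by (intro padic_isotropic_prime_power p) (simp add: v)
  also have "\<dots> \<longleftrightarrow> padic_isotropic p (of_int (int p ^ (v3 + v3) * w3))
      (of_int (int p ^ (v1 + v3) * w1)) (of_int w2)"
    by (rule padic_isotropic_swap13)
  also have "\<dots> \<longleftrightarrow> padic_isotropic p (of_int w3) (of_int (int p ^ (v1 + v3) * w1)) (of_int w2)"
    by (intro padic_isotropic_prime_power p) simp
  also have "\<dots> \<longleftrightarrow> padic_isotropic p (of_int w2) (of_int (int p ^ (v1 + v3) * w1)) (of_int w3)"
    by (rule padic_isotropic_swap13)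
  also have "\<dots> \<longleftrightarrow> padic_isotropic p (of_int (int p ^ (v1 + v3) * w1)) (of_int w2) (of_int w3)"
    by (rule padic_isotropic_swap12)
  also have "\<dots> \<longleftrightarrow> Legendre (- (w2 * w3)) p ^ (v1 + v3) = 1"
  proof (cases "even (v1 + v3)")
    case True
    have "Legendre (- (w2 * w3)) p ^ (v1 + v3) = 1"
      using True Legendre_sign[OF ndw] by auto
    thus ?thesis
      using padic_isotropic_prime_power[OF p(1) True] padic_isotropic_units[OF p nd] by simp
  next
    case False
    then obtain k where k: "v1 + v3 = Suc k" "even k" by (metis even_Suc not0_implies_Suc even_zero)
    have "padic_isotropic p (of_int (int p ^ (v1 + v3) * w1)) (of_int w2) (of_int w3) \<longleftrightarrow>
        padic_isotropic p (of_int (int p * w1)) (of_int w2) (of_int w3)"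
      using padic_isotropic_prime_power[OF p(1) k(2), of "int p * w1"] by (simp add: k(1) mult_ac)
    also have "\<dots> \<longleftrightarrow> QuadRes (int p) (- (w2 * w3))"
      using QuadRes_of_padic_isotropic[OF p(1) nd]
        padic_isotropic_of_QuadRes[OF p, of "- (w2 * w3)" w3 "int p * w1" 0 w2 1] ndw
      by (auto simp: mult_ac)
    also have "\<dots> \<longleftrightarrow> Legendre (- (w2 * w3)) p ^ (v1 + v3) = 1"
      using k Legendre_eq_1_iff[OF ndw] Legendre_sign[OF ndw] by (auto simp: k(1))
    finally show ?thesis .
  qed
  finally show ?thesis by (simp add: v w)
qed

section \<open>Comparison of the Hilbert symbol with the tame formula\<close>

text \<open>The second argument -u2 u3 has even valuation, so only the Legendre symbol of its unit
  part survives, raised to the valuation of the first argument.\<close>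

lemma tame_ternary_symbol_eq_Legendre:
  assumes p: "prime p" "2 < p" and u: "u1 \<noteq> 0" "u2 \<noteq> 0" "u3 \<noteq> 0"
    and even: "even (multiplicity (int p) u2 + multiplicity (int p) u3)"
  shows "ternary_symbol (tame_symbol p) u1 u2 u3 =
    Legendre (- (unit_part p u2 * unit_part p u3)) p ^
      (multiplicity (int p) u1 + multiplicity (int p) u3)"
proof -
  have P: "prime (int p)" using p by simp
  have "\<not> int p dvd - 1" using P by auto
  hence L1: "Legendre (-1) (int p) = 1 \<or> Legendre (-1) (int p) = -1" by (rule Legendre_sign)
  have "\<not> int p dvd - (unit_part p u1 * unit_part p u3)"
    using u P unit_part_not_dvd by (simp add: prime_dvd_mult_iff)
  from Legendre_sign[OF this] L1 even show ?thesis
    using u P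
    by (auto simp: ternary_symbol_def tame_symbol_def unit_part_minus unit_part_mult
        multiplicity_minus_int prime_elem_multiplicity_mult_distrib)
qed

text \<open>Two of the three valuations have equal parity. Isotropy and the tame ternary symbol are
  both symmetric in the coefficients, so such a pair can be moved to the last two slots, where both
  are given by the same Legendre power.\<close>

theorem hilbert_symbol_eq_tame:
  assumes p: "prime p" "2 < p" and u: "u1 \<noteq> 0" "u2 \<noteq> 0" "u3 \<noteq> 0"
  shows "hilbert_symbol p (padic_of_rat p (- of_int u1 / of_int u3)) (padic_of_rat p (- of_int u2 / of_int u3)) =
    ternary_symbol (tame_symbol p) u1 u2 u3"
proof -
  interpret steinberg_symbol "tame_symbol p" by (rule steinberg_symbol_tame[OF p])
  define iso where "iso a b c \<longleftrightarrow> padic_isotropic p (of_int a) (of_int b) (of_int c)" for a b c :: int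
  let ?T = "ternary_symbol (tame_symbol p)"
  have main: "iso a b c \<longleftrightarrow> ?T a b c = 1"
    if "a \<noteq> 0" "b \<noteq> 0" "c \<noteq> 0" "even (multiplicity (int p) b + multiplicity (int p) c)" for a b c
    using padic_isotropic_iff_Legendre[OF p that] tame_ternary_symbol_eq_Legendre[OF p that]
    by (simp add: iso_def)
  have "even (multiplicity (int p) u2 + multiplicity (int p) u3) \<or>
      even (multiplicity (int p) u1 + multiplicity (int p) u3) \<or>
      even (multiplicity (int p) u2 + multiplicity (int p) u1)" by auto
  hence "iso u1 u2 u3 \<longleftrightarrow> ?T u1 u2 u3 = 1"
    using main[of u1 u2 u3] main[of u2 u1 u3] main[of u3 u2 u1] u
      ternary_swap12[of u1 u2 u3] ternary_swap13[of u1 u2 u3]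
      padic_isotropic_swap12[of p "of_int u1"] padic_isotropic_swap13[of p "of_int u1"]
    unfolding iso_def by metis
  moreover have "?T u1 u2 u3 = 1 \<or> ?T u1 u2 u3 = -1"
    unfolding ternary_symbol_def by (rule sign) (use u in auto)
  ultimately show ?thesis
    using hilbert_symbol_eq_isotropic[OF p(1), of "of_int u3" "of_int u1" "of_int u2"] u
    by (auto simp: iso_def)
qed

subsection \<open>Local triviality away from the denominator\<close>

text \<open>The lowest power of p on the left, p^(v1+v2), is cancelled; the ordering of the
  valuations makes the truncated subtractions exact.\<close>

lemma unit_part_relation:
  fixes n p u1 u2 u3 :: int
  defines "v1 \<equiv> multiplicity p u1" and "v2 \<equiv> multiplicity p u2" and "v3 \<equiv> multiplicity p u3"
    and "w1 \<equiv> unit_part p u1" and "w2 \<equiv> unit_part p u2" and "w3 \<equiv> unit_part p u3"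
  assumes p: "prime p" and le: "v1 \<le> v2" "v2 \<le> v3"
    and rel: "n * (u1 * u2 + u1 * u3 + u2 * u3) = 4 * (u1 * u2 * u3)"
  shows "n * (w1 * w2 + p ^ (v3 - v2) * (w1 * w3) + p ^ (v3 - v1) * (w2 * w3)) =
    4 * p ^ v3 * (w1 * w2 * w3)"
proof -
  obtain i where i: "v2 = v1 + i" using le(1) le_Suc_ex by blast
  obtain j where j: "v3 = v2 + j" using le(2) le_Suc_ex by blast
  have u: "u1 = p ^ v1 * w1" "u2 = p ^ v2 * w2" "u3 = p ^ v3 * w3"
    unfolding assms by (rule unit_part_decompose)+
  have "p ^ (v1 + v2) * (n * (w1 * w2 + p ^ (v3 - v2) * (w1 * w3) + p ^ (v3 - v1) * (w2 * w3))) =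
      n * (u1 * u2 + u1 * u3 + u2 * u3)"
    unfolding u by (simp add: i j power_add algebra_simps)
  also have "\<dots> = p ^ (v1 + v2) * (4 * p ^ v3 * (w1 * w2 * w3))"
    unfolding rel by (simp add: u power_add algebra_simps)
  finally show ?thesis using p by (auto simp: prime_gt_0_int)
qed

text \<open>Otherwise p divides every term of the reduced relation except n w1 w2, which is prime to
  p. Positivity of the largest valuation takes care of the right side; p = 2 is allowed.\<close>

lemma max_multiplicity_attained_twice:
  fixes n p u1 u2 u3 :: int
  assumes p: "prime p" "\<not> p dvd n" and u: "u1 \<noteq> 0" "u2 \<noteq> 0" "u3 \<noteq> 0"
    and le: "multiplicity p u1 \<le> multiplicity p u2" "multiplicity p u2 \<le> multiplicity p u3"
    and pos: "0 < multiplicity p u3"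
    and rel: "n * (u1 * u2 + u1 * u3 + u2 * u3) = 4 * (u1 * u2 * u3)"
  shows "multiplicity p u2 = multiplicity p u3"
proof (rule ccontr)
  assume "multiplicity p u2 \<noteq> multiplicity p u3"
  hence "0 < multiplicity p u3 - multiplicity p u2" "0 < multiplicity p u3 - multiplicity p u1"
    using le by auto
  hence d: "p dvd p ^ (multiplicity p u3 - multiplicity p u2)"
    "p dvd p ^ (multiplicity p u3 - multiplicity p u1)" "p dvd p ^ multiplicity p u3"
    using pos by (simp_all add: dvd_power)
  let ?w1 = "unit_part p u1" and ?w2 = "unit_part p u2" and ?w3 = "unit_part p u3"
  have "p dvd 4 * p ^ multiplicity p u3 * (?w1 * ?w2 * ?w3)" using d(3) by simp
  hence "p dvd ?w1 * ?w2 + p ^ (multiplicity p u3 - multiplicity p u2) * (?w1 * ?w3) +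
      p ^ (multiplicity p u3 - multiplicity p u1) * (?w2 * ?w3)"
    using unit_part_relation[OF p(1) le rel] p by (metis prime_dvd_mult_iff)
  hence "p dvd ?w1 * ?w2" using d(1,2) by (simp add: dvd_add_left_iff)
  thus False using unit_part_not_dvd u p by (auto simp: prime_dvd_mult_iff)
qed

lemma tame_ternary_symbol_unramified:
  fixes n :: int
  assumes p: "prime p" "2 < p" "\<not> int p dvd n" and u: "u1 \<noteq> 0" "u2 \<noteq> 0" "u3 \<noteq> 0"
    and rel: "n * (u1 * u2 + u1 * u3 + u2 * u3) = 4 * (u1 * u2 * u3)"
  shows "ternary_symbol (tame_symbol p) u1 u2 u3 = 1"
proof -
  interpret steinberg_symbol "tame_symbol p" by (rule steinberg_symbol_tame[OF p(1,2)])
  let ?v = "multiplicity (int p)"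
  have P: "prime (int p)" using p by simp
  show ?thesis
  proof (rule ternary_symbol_eq_1_by_sorting[where f = ?v and
        Q = "\<lambda>a b c. a \<noteq> 0 \<and> b \<noteq> 0 \<and> c \<noteq> 0 \<and> n * (a * b + a * c + b * c) = 4 * (a * b * c)"])
    fix a b c
    assume Q: "a \<noteq> 0 \<and> b \<noteq> 0 \<and> c \<noteq> 0 \<and> n * (a * b + a * c + b * c) = 4 * (a * b * c)"
      and le: "?v a \<le> ?v b" "?v b \<le> ?v c"
    let ?w1 = "unit_part p a" and ?w2 = "unit_part p b" and ?w3 = "unit_part p c"
    \<comment> \<open>If the largest valuation is 0, all three are 0.\<close>
    have bc: "?v b = ?v c"
      using max_multiplicity_attained_twice[OF P p(3), of a b c] Q le by (cases "?v c = 0") auto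
    hence T: "ternary_symbol (tame_symbol p) a b c = Legendre (- (?w2 * ?w3)) p ^ (?v a + ?v c)"
      using Q by (intro tame_ternary_symbol_eq_Legendre p) auto
    have nd: "\<not> int p dvd ?w1" "\<not> int p dvd ?w2" "\<not> int p dvd ?w3"
      using Q P unit_part_not_dvd by auto
    hence ndw: "\<not> int p dvd - (?w2 * ?w3)" using P by (simp add: prime_dvd_mult_iff)
    show "ternary_symbol (tame_symbol p) a b c = 1"
    proof (cases "?v a = ?v c")
      case True
      thus ?thesis using T Legendre_sign[OF ndw] by (auto simp flip: mult_2)
    next
      case False
      hence d: "int p dvd int p ^ (?v c - ?v a)" "int p dvd int p ^ ?v c"
        using le bc by (simp_all add: dvd_power)
      have "n * (?w1 * (?w2 + ?w3) + int p ^ (?v c - ?v a) * (?w2 * ?w3)) =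
          4 * int p ^ ?v c * (?w1 * ?w2 * ?w3)"
        using unit_part_relation[OF P le, of n] Q bc by (simp add: algebra_simps)
      moreover have "int p dvd 4 * int p ^ ?v c * (?w1 * ?w2 * ?w3)" using d(2) by simp
      ultimately have "int p dvd ?w1 * (?w2 + ?w3) + int p ^ (?v c - ?v a) * (?w2 * ?w3)"
        using p(3) P by (metis prime_dvd_mult_iff)
      hence "int p dvd ?w1 * (?w2 + ?w3)" using d(1) by (simp add: dvd_add_left_iff)
      hence "int p dvd ?w2 + ?w3" using nd P by (simp add: prime_dvd_mult_iff)
      \<comment> \<open>Multiplying by w2 turns w2 = -w3 modulo p into an explicit square root w2 of
        -w2 w3.\<close>
      hence "int p dvd ?w2 * (?w2 + ?w3)" by simp
      hence "[?w2 ^ 2 = - (?w2 * ?w3)] (mod int p)"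
        by (simp add: cong_iff_dvd_diff power2_eq_square algebra_simps)
      hence "Legendre (- (?w2 * ?w3)) p = 1"
        using Legendre_eq_1_iff[OF ndw] by (auto simp: QuadRes_def)
      thus ?thesis using T by simp
    qed
  qed (use u rel in \<open>auto simp: algebra_simps\<close>)
qed

section \<open>The equation at the prime 2\<close>

text \<open>Here k is the gap between the largest and the smallest valuation. For k \<ge> 3, -bc is
  1 modulo 8 and both signs vanish; for k = 2, -bc is 1 modulo 4 and the second sign is squared; for
  k = 1 the two signs must cancel.\<close>

lemma dyadic_signs_eq_1:
  fixes a b c :: int
  assumes odd: "odd a" "odd b" "odd c" and d: "8 dvd a * (b + c) + 2 ^ k * (b * c)" and k: "k > 0"
  shows "odd_sign4 (- (a * c)) (- (b * c)) * odd_sign8 (- (b * c)) ^ k = 1"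
proof -
  consider "k = 1" | "k = 2" | "k \<ge> 3" using k by linarith
  thus ?thesis
  proof cases
    case 1
    define x y z where "x = a mod 8" and "y = b mod 8" and "z = c mod 8"
    have xyz: "x \<in> {1, 3, 5, 7}" "y \<in> {1, 3, 5, 7}" "z \<in> {1, 3, 5, 7}"
      unfolding x_def y_def z_def using odd odd_mod8 by blast+
    have c: "[x = a] (mod 8)" "[y = b] (mod 8)" "[z = c] (mod 8)"
      by (simp_all add: x_def y_def z_def cong_def)
    have "[x * (y + z) + 2 * (y * z) = a * (b + c) + 2 * (b * c)] (mod 8)"
      by (intro cong_add cong_mult cong_refl c)
    hence dx: "8 dvd x * (y + z) + 2 * (y * z)" using d 1 by (simp add: cong_dvd_iff)
    \<comment> \<open>Exhaustive check over triples of odd residues modulo 8.\<close>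
    have "odd_sign4 (- (x * z)) (- (y * z)) * odd_sign8 (- (y * z)) = 1"
      using xyz dx by (auto simp: odd_sign4_def odd_sign8_def)
    moreover have xz: "[- (x * z) = - (a * c)] (mod 8)" and yz: "[- (y * z) = - (b * c)] (mod 8)"
      by (simp_all add: cong_minus_minus_iff cong_mult c)
    moreover have "[- (x * z) = - (a * c)] (mod 4)" "[- (y * z) = - (b * c)] (mod 4)"
      using cong_dvd_modulus[OF xz, of 4] cong_dvd_modulus[OF yz, of 4] by simp_all
    ultimately show ?thesis
      using 1 odd_sign4_cong odd_sign8_cong unfolding cong_def by (metis power_one_right)
  next
    case 2
    have "4 dvd a * (b + c) + 4 * (b * c)" using d 2 dvd_trans[of 4 "8::int"] by simp
    hence "4 dvd a * (b + c)" by (simp add: dvd_add_left_iff)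
    moreover have "coprime 4 a"
      using odd(1) coprime_power_left_iff[of 2 2 a] by (simp add: coprime_left_2_iff_odd)
    ultimately have "4 dvd b + c" by (simp add: coprime_dvd_mult_right_iff)
    hence "4 dvd b * (b + c)" by simp
    moreover have "- (b * c) - b * b = - (b * (b + c))" by (simp add: algebra_simps)
    ultimately have "[- (b * c) = b * b] (mod 4)"
      by (simp only: cong_iff_dvd_diff dvd_minus_iff)
    moreover have "b * b mod 4 = 1"
      using odd_mod4[OF odd(2)] mod_mult_eq[of b 4 b] by auto
    ultimately have "(- (b * c)) mod 4 = 1" by (simp add: cong_def)
    thus ?thesis using 2 odd_sign8_sign[of "- (b * c)"] by (auto simp: odd_sign4_def)
  next
    case 3
    have "(2::int) ^ 3 dvd 2 ^ k" using 3 by (rule le_imp_power_dvd)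
    hence "8 dvd 2 ^ k * (b * c)" by simp
    hence "8 dvd a * (b + c)" using d by (simp add: dvd_add_left_iff)
    moreover have "coprime 8 a"
      using odd(1) coprime_power_left_iff[of 2 3 a] by (simp add: coprime_left_2_iff_odd)
    ultimately have "8 dvd b + c" by (simp add: coprime_dvd_mult_right_iff)
    hence "8 dvd b * (b + c)" by simp
    moreover have "- (b * c) - b * b = - (b * (b + c))" by (simp add: algebra_simps)
    ultimately have "[- (b * c) = b * b] (mod 8)"
      by (simp only: cong_iff_dvd_diff dvd_minus_iff)
    moreover have "b * b mod 8 = 1"
      using odd_mod8[OF odd(2)] mod_mult_eq[of b 8 b] by auto
    ultimately have m: "(- (b * c)) mod 8 = 1" by (simp add: cong_def)
    hence "(- (b * c)) mod 4 = 1" using mod_mod_cancel[of 4 8 "- (b * c)"] by simp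
    thus ?thesis using m by (simp add: odd_sign4_def odd_sign8_def)
  qed
qed

lemma dyadic_ternary_symbol_eq_1:
  fixes n :: int
  assumes n: "odd n" and u: "u1 \<noteq> 0" "u2 \<noteq> 0" "u3 \<noteq> 0"
    and rel: "n * (u1 * u2 + u1 * u3 + u2 * u3) = 4 * (u1 * u2 * u3)"
  shows "ternary_symbol dyadic_symbol u1 u2 u3 = 1"
proof -
  interpret steinberg_symbol dyadic_symbol by (rule steinberg_symbol_dyadic)
  let ?v = "multiplicity (2::int)"
  show ?thesis
  proof (rule ternary_symbol_eq_1_by_sorting[where f = ?v and
        Q = "\<lambda>a b c. a \<noteq> 0 \<and> b \<noteq> 0 \<and> c \<noteq> 0 \<and> n * (a * b + a * c + b * c) = 4 * (a * b * c)"])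
    fix a b c
    assume Q: "a \<noteq> 0 \<and> b \<noteq> 0 \<and> c \<noteq> 0 \<and> n * (a * b + a * c + b * c) = 4 * (a * b * c)"
      and le: "?v a \<le> ?v b" "?v b \<le> ?v c"
    define x y z where "x = unit_part 2 a" and "y = unit_part 2 b" and "z = unit_part 2 c"
    have odd: "odd x" "odd y" "odd z"
      unfolding x_def y_def z_def using Q unit_part_not_dvd[of _ 2] by auto
    have rel': "n * (x * y + 2 ^ (?v c - ?v b) * (x * z) + 2 ^ (?v c - ?v a) * (y * z)) =
        4 * 2 ^ ?v c * (x * y * z)"
      unfolding x_def y_def z_def by (rule unit_part_relation[OF _ le]) (use Q in auto)
    have even_factor: "even (x * y + 2 ^ (?v c - ?v b) * (x * z) + 2 ^ (?v c - ?v a) * (y * z))"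
      using arg_cong[OF rel', of even] n by simp
    \<comment> \<open>With all valuations 0 the bracket would be a sum of three odd numbers, yet it
      is even since n is odd.\<close>
    have pos: "?v c > 0"
    proof (rule ccontr)
      assume "\<not> ?v c > 0"
      hence "?v c = 0" "?v b = 0" "?v a = 0" using le by auto
      thus False using even_factor odd by simp
    qed
    have bc: "?v b = ?v c"
      by (rule max_multiplicity_attained_twice[of 2 n a b c]) (use n Q le pos in auto)
    define k where "k = ?v c - ?v a"
    have vc: "?v c = ?v a + k" using le by (simp add: k_def)
    \<comment> \<open>A zero gap means three equal valuations, so the same parity contradiction
      arises.\<close>
    have k: "k > 0"
    proof (rule ccontr)
      assume "\<not> k > 0"
      thus False using even_factor odd bc by (simp add: k_def)
    qed
    \<comment> \<open>The factor 4 of the equation together with one factor 2 from the positive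
      largest valuation gives 8.\<close>
    have "8 dvd n * (x * (y + z) + 2 ^ k * (y * z))"
    proof -
      obtain j where "?v c = Suc j" using pos not0_implies_Suc by auto
      hence "n * (x * (y + z) + 2 ^ k * (y * z)) = 8 * (2 ^ j * (x * y * z))"
        using rel' bc by (simp add: k_def algebra_simps)
      thus ?thesis by simp
    qed
    moreover have "coprime 8 n"
      using n coprime_power_left_iff[of 2 3 n] by (simp add: coprime_left_2_iff_odd)
    ultimately have d: "8 dvd x * (y + z) + 2 ^ k * (y * z)"
      by (simp add: coprime_dvd_mult_right_iff)
    \<comment> \<open>The arguments -ac and -bc have valuations 2 v(a) + k and 2 v(c); only k
      survives modulo 2.\<close>
    have "ternary_symbol dyadic_symbol a b c =
        odd_sign4 (- (x * z)) (- (y * z)) * odd_sign8 (- (x * z)) ^ (?v c + ?v c) *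
        odd_sign8 (- (y * z)) ^ (?v a + ?v a + k)"
      using Q by (simp add: ternary_symbol_def dyadic_symbol_def unit_part_minus unit_part_mult
          multiplicity_minus_int prime_elem_multiplicity_mult_distrib bc vc x_def y_def z_def ac_simps)
    also have "\<dots> = odd_sign4 (- (x * z)) (- (y * z)) * odd_sign8 (- (y * z)) ^ k"
      using odd_sign8_sign[of "- (x * z)"] odd_sign8_sign[of "- (y * z)"]
      by (auto simp: power_add simp flip: power_mult_distrib)
    also have "\<dots> = 1" by (rule dyadic_signs_eq_1[OF odd d k])
    finally show "ternary_symbol dyadic_symbol a b c = 1" .
  qed (use u rel in \<open>auto simp: algebra_simps\<close>)
qed

section \<open>Assembly of the local results\<close>

theorem theorem1p5:
  fixes n :: nat and u1 u2 u3 :: int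
  assumes "n > 0" and "odd n"
    and "u1 \<noteq> 0" and "u2 \<noteq> 0" and "u3 \<noteq> 0"
    and "4 / (of_nat n :: rat) = 1 / of_int u1 + 1 / of_int u2 + 1 / of_int u3"
    and "u1 < 0 \<or> u2 < 0 \<or> u3 < 0"
  shows "(\<Prod>p\<in>{p. prime p \<and> p dvd n}.
            hilbert_symbol p (padic_of_rat p (- of_int u1 / of_int u3))
                             (padic_of_rat p (- of_int u2 / of_int u3))) = 1"
proof -
  note u = assms(3-5)
  let ?T = "\<lambda>p. ternary_symbol (tame_symbol p) u1 u2 u3"
  have "(of_int (int n * (u1 * u2 + u1 * u3 + u2 * u3)) :: rat) = of_int (4 * (u1 * u2 * u3))"
  proof -
    have "(of_int (int n * (u1 * u2 + u1 * u3 + u2 * u3)) :: rat) =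
        of_nat n * (1 / of_int u1 + 1 / of_int u2 + 1 / of_int u3) * of_int (u1 * u2 * u3)"
      using u by (simp add: field_simps)
    also have "\<dots> = of_int (4 * (u1 * u2 * u3))"
      using assms(1) by (simp flip: assms(6))
    finally show ?thesis .
  qed
  hence rel: "int n * (u1 * u2 + u1 * u3 + u2 * u3) = 4 * (u1 * u2 * u3)"
    by (simp only: of_int_eq_iff)
  \<comment> \<open>The left side 4/n is positive, so not all reciprocals are negative; with a
    negative coefficient present, the signs are mixed.\<close>
  have "u1 > 0 \<or> u2 > 0 \<or> u3 > 0"
  proof (rule ccontr)
    assume "\<not> ?thesis"
    hence "1 / (of_int u1 :: rat) \<le> 0" "1 / (of_int u2 :: rat) \<le> 0" "1 / (of_int u3 :: rat) \<le> 0"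
      by (simp_all add: divide_le_0_iff)
    hence "4 / (of_nat n :: rat) \<le> 0" using assms(6) by linarith
    thus False using assms(1) by (simp add: divide_le_0_iff)
  qed
  hence real: "ternary_symbol real_symbol u1 u2 u3 = 1"
    using assms(7) u by (auto simp: ternary_symbol_def real_symbol_def zero_less_mult_iff)
  \<comment> \<open>This finite set contains the primes dividing the coefficients, as the product
    formula requires, and those dividing n, whose product is sought.\<close>
  define S where "S = {p. prime p \<and> int p dvd 2 * int n * (u1 * u2 * u3)}"
  have nz: "2 * int n * (u1 * u2 * u3) \<noteq> 0" using assms(1) u by simp
  have "finite S"
  proof (rule finite_subset)
    show "S \<subseteq> nat ` {d. d dvd 2 * int n * (u1 * u2 * u3)}"
      by (auto simp: S_def intro!: image_eqI[of _ nat "int _"])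
    show "finite (nat ` {d. d dvd 2 * int n * (u1 * u2 * u3)})"
      using nz by simp
  qed
  have gt2: "2 < p" if "p \<in> S - {2}" for p
    using that prime_ge_2_nat[of p] by (auto simp: S_def)
  have sub: "{p. prime p \<and> p dvd n} \<subseteq> S - {2}"
    using assms(2) by (auto simp: S_def)
  have "ternary_symbol real_symbol u1 u2 u3 * ternary_symbol dyadic_symbol u1 u2 u3 *
      (\<Prod>p\<in>S - {2}. ?T p) = 1"
    unfolding ternary_symbol_def
    by (rule product_formula[OF \<open>finite S\<close>])
      (use u in \<open>auto simp: S_def prime_dvd_mult_iff\<close>)
  hence "(\<Prod>p\<in>S - {2}. ?T p) = 1"
    using real dyadic_ternary_symbol_eq_1[OF _ u rel] assms(2) by simp
  \<comment> \<open>Odd primes of \<open>S\<close> not dividing n contribute 1; as n is odd,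
    removing 2 loses no prime divisor of n.\<close>
  moreover have "(\<Prod>p\<in>S - {2}. ?T p) = (\<Prod>p\<in>{p. prime p \<and> p dvd n}. ?T p)"
    using \<open>finite S\<close> sub gt2
    by (intro prod.mono_neutral_right ballI tame_ternary_symbol_unramified[OF _ _ _ u rel])
      (auto simp: S_def)
  moreover have "(\<Prod>p\<in>{p. prime p \<and> p dvd n}. ?T p) = (\<Prod>p\<in>{p. prime p \<and> p dvd n}.
      hilbert_symbol p (padic_of_rat p (- of_int u1 / of_int u3)) (padic_of_rat p (- of_int u2 / of_int u3)))"
    using sub gt2 u by (intro prod.cong refl hilbert_symbol_eq_tame[symmetric]) auto
  ultimately show ?thesis by simp
qed

end
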